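(* Assume that $(a_* )$, $(a_+)$, $(g_1)$, $(g_2)$ and $(g_3)$ hold. Let $M>0$ be such that, for every $\lambda\ge M$, $u_\lambda$ is a solution of $$-\operatorname{div}\left(\frac{\nabla u}{\sqrt{1-|\nabla u|^2}}\right)=\lambda a(x)g(u)\ \text{ in }\Omega,\qquad \frac{\nabla u}{\sqrt{1-|\nabla u|^2}}\cdot\mathbf n=0\ \text{ on }\partial\Omega$$ satisfying $$I_\lambda(u_\lambda)=\inf_{u\in C(\overline\Omega)}I_\lambda(u).$$ Then, up to a subsequence (that is, every sequence $\lambda_n\to+\infty$ in $[M,+\infty)$ has a subsequence along which the convergence holds), $$u_\lambda\to u_\infty\quad\text{uniformly in }\overline\Omega\text{ as }\lambda\to+\infty,$$ where $u_\infty\in K_a$ solves the maximum problem $$\max_{u\in K_a}\int_\Omega a(x)G(u)\,dx,$$ and $u_\infty\not\equiv0$. In particular, for any family $\{u_\lambda^{(l)}\}_{\lambda\ge M}$ of non-trivial solutions with $I_\lambda(u_\lambda^{(l)})=\inf_{C(\overline\Omega)}I_\lambda<0$ (ground-state solutions), up to a subsequence, $u_\lambda^{(l)}\to u_\infty$ uniformly in $\overline\Omega$ as $\lambda\to+\infty$, where $u_\infty\in K_a$ solves the maximum problem $\max_{u\in K_a}\int_\Omega a(x)G(u)\,dx$ and $u_\infty\not\equiv0$.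
   Context: $\Omega\subset\mathbb R^N$ is a bounded convex domain, $N\ge2$, with $\partial\Omega\in C^2$, and $\mathbf n$ is the exterior normal vector; $a:\Omega\to\mathbb R$, $g:\mathbb R\to\mathbb R$, and $G(s):=\int_0^s g(t)\,dt$. Hypotheses: - $(a_* )$: $a\in L^\infty(\Omega)$ and $\int_\Omega a(x)\,dx<0$. - $(a_+)$: the set $\{x\in\Omega: a(x)>0\}$ has nonempty interior. - $(g_1)$: $g\in C^1(\mathbb R)$ and $g(s)s>0$ for every $s\ne0$. - $(g_2)$: there exist $p>1$ and $c>0$ such that $\lim_{|s|\to+\infty}\frac{g(s)}{|s|^{p-2}s}=c$. - $(g_3)$: $\lim_{s\to0}\frac{g^2(s)}{G(s)}=0$. Solution: $u\in W^{1,\infty}(\Omega)$ with $\|\nabla u\|_{L^\infty(\Omega)}<1$ and $\int_\Omega\frac{\nabla u\cdot\nabla\phi}{\sqrt{1-|\nabla u|^2}}\,dx=\lambda\int_\Omega a(x)g(u)\phi\,dx$ for every $\phi\in C^1(\overline\Omega)$. $K:=\{u\in W^{1,\infty}(\Omega):\|\nabla u\|_{L^\infty(\Omega)}\le1\}\subset C(\overline\Omega)$ and $K_a:=\{u\in K:\int_\Omega a(x)g(u)\,dx=0\}$. The functional $I_\lambda:C(\overline\Omega)\to(-\infty,+\infty]$ is $I_\lambda=\Psi+\Phi_\lambda$, where $\Psi(u)=\int_\Omega(1-\sqrt{1-|\nabla u|^2})\,dx$ if $u\in K$, $\Psi(u)=+\infty$ if $u\in C(\overline\Omega)\setminus K$,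 and $\Phi_\lambda(u)=-\lambda\int_\Omega a(x)G(u)\,dx$. *)

theory Defs
  imports "HOL-Probability.Essential_Supremum"
begin

definition C2_function :: "('a::euclidean_space \<Rightarrow> real) \<Rightarrow> bool" where
  "C2_function f \<longleftrightarrow>
     (\<exists>(D :: 'a \<Rightarrow> 'a) (H :: 'a \<Rightarrow> 'a \<Rightarrow>\<^sub>L 'a).
        (\<forall>x. GDERIV f x :> D x) \<and>
        (\<forall>x. (D has_derivative blinfun_apply (H x)) (at x)) \<and>
        continuous_on UNIV H)"

text \<open>
  Near every boundary point the domain is the strict epigraph of a \<open>C\<^sup>2\<close> function of the
  \<open>N - 1\<close> coordinates orthogonal to some unit vector \<open>\<nu>\<close>; these coordinates of \<open>x\<close> are
  represented by the projection \<open>x - (x \<bullet> \<nu>) *\<^sub>R \<nu>\<close>, so that only the values of \<open>\<gamma>\<close> on the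
  hyperplane orthogonal to \<open>\<nu>\<close> matter.
\<close>

definition C2_boundary :: "'a::euclidean_space set \<Rightarrow> bool" where
  "C2_boundary \<Omega> \<longleftrightarrow>
     (\<forall>x0\<in>frontier \<Omega>. \<exists>r>0. \<exists>\<nu> \<gamma>.
        norm \<nu> = 1 \<and> C2_function \<gamma> \<and>
        \<Omega> \<inter> ball x0 r = {x \<in> ball x0 r. \<gamma> (x - (x \<bullet> \<nu>) *\<^sub>R \<nu>) < x \<bullet> \<nu>})"

definition bounded_convex_C2_domain :: "'a::euclidean_space set \<Rightarrow> bool" where
  "bounded_convex_C2_domain \<Omega> \<longleftrightarrow>
     \<Omega> \<noteq> {} \<and> open \<Omega> \<and> bounded \<Omega> \<and> convex \<Omega> \<and> C2_boundary \<Omega>"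

definition Linf_norm :: "'a::euclidean_space set \<Rightarrow> ('a \<Rightarrow> 'b::euclidean_space) \<Rightarrow> ereal" where
  "Linf_norm \<Omega> f = esssup (lebesgue_on \<Omega>) (\<lambda>x. ereal (norm (f x)))"

definition Linf :: "'a::euclidean_space set \<Rightarrow> ('a \<Rightarrow> 'b::euclidean_space) set" where
  "Linf \<Omega> = {f \<in> borel_measurable (lebesgue_on \<Omega>). Linf_norm \<Omega> f < \<infinity>}"

text \<open>
  \<open>C1c_test \<Omega> \<phi> D\<close>: \<open>\<phi>\<close> belongs to \<open>C\<^sub>c\<^sup>1(\<Omega>)\<close>, extended by zero to the whole space, and \<open>D\<close> is
  its gradient. Testing weak derivatives against \<open>C\<^sub>c\<^sup>1\<close> instead of \<open>C\<^sub>c\<^sup>\<infinity>\<close> functions is equivalent (Gilbarg--Trudinger).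
\<close>

definition C1c_test :: "'a::euclidean_space set \<Rightarrow> ('a \<Rightarrow> real) \<Rightarrow> ('a \<Rightarrow> 'a) \<Rightarrow> bool" where
  "C1c_test \<Omega> \<phi> D \<longleftrightarrow>
     (\<forall>x. GDERIV \<phi> x :> D x) \<and> continuous_on UNIV D \<and>
     (\<exists>S. compact S \<and> S \<subseteq> \<Omega> \<and> (\<forall>x. x \<notin> S \<longrightarrow> \<phi> x = 0))"

definition is_weak_gradient :: "'a::euclidean_space set \<Rightarrow> ('a \<Rightarrow> real) \<Rightarrow> ('a \<Rightarrow> 'a) \<Rightarrow> bool" where
  "is_weak_gradient \<Omega> u V \<longleftrightarrow>
     (\<forall>\<phi> D. C1c_test \<Omega> \<phi> D \<longrightarrow>
        (\<integral>x. u x *\<^sub>R D x \<partial>lebesgue_on \<Omega>) = - (\<integral>x. \<phi> x *\<^sub>R V x \<partial>lebesgue_on \<Omega>))"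

definition W1inf :: "'a::euclidean_space set \<Rightarrow> ('a \<Rightarrow> real) set" where
  "W1inf \<Omega> = {u \<in> Linf \<Omega>. \<exists>V \<in> Linf \<Omega>. is_weak_gradient \<Omega> u V}"

text \<open>
  On an open set the weak gradient is unique up to null sets; this picks a representative.
\<close>

definition wgrad :: "'a::euclidean_space set \<Rightarrow> ('a \<Rightarrow> real) \<Rightarrow> 'a \<Rightarrow> 'a" where
  "wgrad \<Omega> u = (SOME V. V \<in> Linf \<Omega> \<and> is_weak_gradient \<Omega> u V)"

text \<open>
  Elements of \<open>C(closure \<Omega>)\<close> are functions on the whole space of which only the values on
  \<open>closure \<Omega>\<close> are used.
\<close>

definition C_closure :: "'a::euclidean_space set \<Rightarrow> ('a \<Rightarrow> real) set" where
  "C_closure \<Omega> = {u. continuous_on (closure \<Omega>) u}"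

text \<open>
  \<open>C1_closure \<Omega> \<phi> D\<close>: \<open>\<phi>\<close> belongs to \<open>C\<^sup>1(closure \<Omega>)\<close>, and \<open>D\<close> is its gradient, extended
  continuously to \<open>closure \<Omega>\<close>.
\<close>

definition C1_closure :: "'a::euclidean_space set \<Rightarrow> ('a \<Rightarrow> real) \<Rightarrow> ('a \<Rightarrow> 'a) \<Rightarrow> bool" where
  "C1_closure \<Omega> \<phi> D \<longleftrightarrow>
     continuous_on (closure \<Omega>) \<phi> \<and> continuous_on (closure \<Omega>) D \<and>
     (\<forall>x\<in>\<Omega>. GDERIV \<phi> x :> D x)"

definition a_star :: "'a::euclidean_space set \<Rightarrow> ('a \<Rightarrow> real) \<Rightarrow> bool" where
  "a_star \<Omega> a \<longleftrightarrow> a \<in> Linf \<Omega> \<and> (\<integral>x. a x \<partial>lebesgue_on \<Omega>) < 0"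

definition a_plus :: "'a::euclidean_space set \<Rightarrow> ('a \<Rightarrow> real) \<Rightarrow> bool" where
  "a_plus \<Omega> a \<longleftrightarrow> interior {x \<in> \<Omega>. a x > 0} \<noteq> {}"

text \<open>The interval integral is oriented, so \<open>primitive g s\<close> is also correct for \<open>s < 0\<close>.\<close>

definition primitive :: "(real \<Rightarrow> real) \<Rightarrow> real \<Rightarrow> real" where
  "primitive g s = (LBINT t=ereal 0..ereal s. g t)"

definition g_1 :: "(real \<Rightarrow> real) \<Rightarrow> bool" where
  "g_1 g \<longleftrightarrow>
     (\<exists>g'. (\<forall>s. (g has_real_derivative g' s) (at s)) \<and> continuous_on UNIV g') \<and>
     (\<forall>s. s \<noteq> 0 \<longrightarrow> g s * s > 0)"

definition g_2 :: "(real \<Rightarrow> real) \<Rightarrow> bool" where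
  "g_2 g \<longleftrightarrow>
     (\<exists>p>1. \<exists>c>0. ((\<lambda>s. g s / (\<bar>s\<bar> powr (p - 2) * s)) \<longlongrightarrow> c) at_infinity)"

definition g_3 :: "(real \<Rightarrow> real) \<Rightarrow> bool" where
  "g_3 g \<longleftrightarrow> ((\<lambda>s. (g s)\<^sup>2 / primitive g s) \<longlongrightarrow> 0) (at 0)"

text \<open>
  As \<open>\<Omega>\<close> is bounded and convex, every class in \<open>W\<^sup>1\<^sup>,\<^sup>\<infinity>(\<Omega>)\<close> has a unique representative that is
  continuous on \<open>closure \<Omega>\<close>. A solution, and likewise an element of \<open>K_set\<close> below, is identified
  with that representative.
\<close>

definition is_solution ::
  "'a::euclidean_space set \<Rightarrow> ('a \<Rightarrow> real) \<Rightarrow> (real \<Rightarrow> real) \<Rightarrow> real \<Rightarrow> ('a \<Rightarrow> real) \<Rightarrow> bool" where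
  "is_solution \<Omega> a g lam u \<longleftrightarrow>
     u \<in> C_closure \<Omega> \<and> u \<in> W1inf \<Omega> \<and> Linf_norm \<Omega> (wgrad \<Omega> u) < 1 \<and>
     (\<forall>\<phi> D. C1_closure \<Omega> \<phi> D \<longrightarrow>
        (\<integral>x. (wgrad \<Omega> u x \<bullet> D x) / sqrt (1 - (norm (wgrad \<Omega> u x))\<^sup>2) \<partial>lebesgue_on \<Omega>)
          = lam * (\<integral>x. a x * g (u x) * \<phi> x \<partial>lebesgue_on \<Omega>))"

definition K_set :: "'a::euclidean_space set \<Rightarrow> ('a \<Rightarrow> real) set" where
  "K_set \<Omega> = {u \<in> C_closure \<Omega>. u \<in> W1inf \<Omega> \<and> Linf_norm \<Omega> (wgrad \<Omega> u) \<le> 1}"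

definition K_a :: "'a::euclidean_space set \<Rightarrow> ('a \<Rightarrow> real) \<Rightarrow> (real \<Rightarrow> real) \<Rightarrow> ('a \<Rightarrow> real) set" where
  "K_a \<Omega> a g = {u \<in> K_set \<Omega>. (\<integral>x. a x * g (u x) \<partial>lebesgue_on \<Omega>) = 0}"

definition \<Psi> :: "'a::euclidean_space set \<Rightarrow> ('a \<Rightarrow> real) \<Rightarrow> ereal" where
  "\<Psi> \<Omega> u =
     (if u \<in> K_set \<Omega>
      then ereal (\<integral>x. (1 - sqrt (1 - (norm (wgrad \<Omega> u x))\<^sup>2)) \<partial>lebesgue_on \<Omega>)
      else \<infinity>)"

definition G_integral ::
  "'a::euclidean_space set \<Rightarrow> ('a \<Rightarrow> real) \<Rightarrow> (real \<Rightarrow> real) \<Rightarrow> ('a \<Rightarrow> real) \<Rightarrow> real" where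
  "G_integral \<Omega> a g u = (\<integral>x. a x * primitive g (u x) \<partial>lebesgue_on \<Omega>)"

definition I_functional ::
  "'a::euclidean_space set \<Rightarrow> ('a \<Rightarrow> real) \<Rightarrow> (real \<Rightarrow> real) \<Rightarrow> real \<Rightarrow> ('a \<Rightarrow> real) \<Rightarrow> ereal" where
  "I_functional \<Omega> a g lam u = \<Psi> \<Omega> u + ereal (- lam * G_integral \<Omega> a g u)"

definition I_inf ::
  "'a::euclidean_space set \<Rightarrow> ('a \<Rightarrow> real) \<Rightarrow> (real \<Rightarrow> real) \<Rightarrow> real \<Rightarrow> ereal" where
  "I_inf \<Omega> a g lam = (INF v\<in>C_closure \<Omega>. I_functional \<Omega> a g lam v)"

definition solves_max_problem ::
  "'a::euclidean_space set \<Rightarrow> ('a \<Rightarrow> real) \<Rightarrow> (real \<Rightarrow> real) \<Rightarrow> ('a \<Rightarrow> real) \<Rightarrow> bool" where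
  "solves_max_problem \<Omega> a g u \<longleftrightarrow>
     u \<in> K_a \<Omega> a g \<and> (\<forall>v\<in>K_a \<Omega> a g. G_integral \<Omega> a g v \<le> G_integral \<Omega> a g u)"

definition nontrivial_on_closure :: "'a::euclidean_space set \<Rightarrow> ('a \<Rightarrow> real) \<Rightarrow> bool" where
  "nontrivial_on_closure \<Omega> u \<longleftrightarrow> (\<exists>x\<in>closure \<Omega>. u x \<noteq> 0)"

text \<open>
  Uniform convergence in \<open>closure \<Omega>\<close>, up to a subsequence, as \<open>\<lambda> \<rightarrow> +\<infinity>\<close>, of a family indexed by
  \<open>\<lambda> \<ge> M\<close>; the limit may depend on the sequence and on the subsequence.
\<close>

definition subconverges_to_maximizer ::
  "'a::euclidean_space set \<Rightarrow> ('a \<Rightarrow> real) \<Rightarrow> (real \<Rightarrow> real) \<Rightarrow> real \<Rightarrow> (real \<Rightarrow> 'a \<Rightarrow> real) \<Rightarrow> bool" where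
  "subconverges_to_maximizer \<Omega> a g M u \<longleftrightarrow>
     (\<forall>l :: nat \<Rightarrow> real. (\<forall>n. l n \<ge> M) \<longrightarrow> filterlim l at_top sequentially \<longrightarrow>
        (\<exists>r u_inf. strict_mono (r :: nat \<Rightarrow> nat) \<and>
           uniform_limit (closure \<Omega>) (\<lambda>n. u (l (r n))) u_inf sequentially \<and>
           solves_max_problem \<Omega> a g u_inf \<and> nontrivial_on_closure \<Omega> u_inf))"

end

theory Submission
  imports Defs "HOL-Complex_Analysis.Great_Picard"
begin

text \<open>
  Write \<open>K\<close> for \<open>K_set \<Omega>\<close> and \<open>J u\<close> for \<open>G_integral \<Omega> a g u\<close>, so that the functional to be minimised is
  \<open>\<Psi> u - lam * J u\<close> on \<open>K\<close>. On \<open>K\<close> the values of \<open>\<Psi>\<close> lie between \<open>0\<close> and the measure of \<open>\<Omega>\<close>. Hence a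
  minimiser \<open>u\<close> satisfies \<open>J v \<le> J u + measure lebesgue \<Omega> / lam\<close> for every \<open>v\<close> in \<open>K\<close>
  (\<open>minimizer_G_integral_almost_maximal\<close>): as \<open>lam \<rightarrow> \<infinity>\<close>, minimisers nearly maximise \<open>J\<close> over the whole
  of \<open>K\<close>. Every solution also lies in \<open>K_a \<Omega> a g\<close>, as one sees by testing the equation with
  \<open>\<phi> = 1\<close>. So it suffices that \<open>K_a \<Omega> a g\<close> is compact in \<open>C(closure \<Omega>)\<close>
  (\<open>K_a_subsequence_uniform_limit\<close>): a uniform limit of solutions is then an element of \<open>K_a \<Omega> a g\<close> that
  maximises \<open>J\<close> over \<open>K\<close>. It is not zero, since \<open>J\<close> vanishes at \<open>0\<close> and is positive at a small bump
  supported where \<open>a\<close> is positive (\<open>exists_K_set_positive_G_integral\<close>).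

  Compactness rests on three facts.

  \<^item> Elements of \<open>K\<close> are Lipschitz with constant \<open>1\<close> on the convex set \<open>closure \<Omega>\<close>
    (\<open>K_set_lipschitz\<close>); one averages \<open>u\<close> against a bump that moves along a segment.

  \<^item> \<open>K_a \<Omega> a g\<close> is bounded (\<open>K_a_uniformly_bounded\<close>). As the oscillation of \<open>u\<close> is bounded, the power
    growth of \<open>g\<close> makes \<open>g (u x)\<close> nearly constant relative to its size when \<open>u\<close> is large, and then the
    integral of \<open>a x * g (u x)\<close> cannot vanish, because the integral of \<open>a\<close> is negative.

  \<^item> \<open>K\<close> is closed under uniform limits (\<open>K_set_closed_uniform_limit\<close>). The weak gradient of the limit
    is constructed directly from the gradients of the approximants: among the weak gradients of
    functions near the limit, nearly minimal elements for the \<open>L\<^sup>2\<close> norm form a sequence that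
    converges almost everywhere (\<open>midpoint_convex_selection_AE_convergent\<close>).

  Since \<open>wgrad\<close> is a choice of some weak gradient, statements about it require that weak gradients
  are unique almost everywhere (\<open>weak_gradient_unique\<close>).
\<close>

section \<open>Continuously differentiable functions and box bumps\<close>

definition C1_gradient :: "('a::euclidean_space \<Rightarrow> real) \<Rightarrow> ('a \<Rightarrow> 'a) \<Rightarrow> bool" where
  "C1_gradient f D \<longleftrightarrow> (\<forall>x. GDERIV f x :> D x) \<and> continuous_on UNIV D"

lemma C1_gradient_continuous:
  assumes "C1_gradient f D" shows "continuous_on UNIV f"
  using assms unfolding C1_gradient_def gderiv_def
  by (meson continuous_at_imp_continuous_on has_derivative_continuous)

lemma C1_gradient_const: "C1_gradient (\<lambda>x. c) (\<lambda>x. 0)"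
  unfolding C1_gradient_def by (auto intro: GDERIV_const)

lemma C1_gradient_mult:
  assumes "C1_gradient f D" "C1_gradient h E"
  shows "C1_gradient (\<lambda>x. f x * h x) (\<lambda>x. f x *\<^sub>R E x + h x *\<^sub>R D x)"
  using assms C1_gradient_continuous[OF assms(1)] C1_gradient_continuous[OF assms(2)]
  unfolding C1_gradient_def by (auto intro!: GDERIV_mult continuous_intros)

lemma C1_gradient_prod:
  assumes "finite I" "\<And>i. i \<in> I \<Longrightarrow> \<exists>D. C1_gradient (f i) D"
  shows "\<exists>D. C1_gradient (\<lambda>x. \<Prod>i\<in>I. f i x) D"
  using assms
proof (induction I)
  case empty
  show ?case using C1_gradient_const[of 1] by auto
next
  case (insert j I)
  obtain D where D: "C1_gradient (f j) D" using insert.prems by blast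
  obtain E where E: "C1_gradient (\<lambda>x. \<Prod>i\<in>I. f i x) E" using insert.prems insert.IH by blast
  show ?case using C1_gradient_mult[OF D E] insert.hyps by auto
qed

lemma C1_gradient_translate:
  assumes "C1_gradient f D"
  shows "C1_gradient (\<lambda>x. f (x - y)) (\<lambda>x. D (x - y))"
  unfolding C1_gradient_def
proof (intro conjI allI)
  fix x
  have "(f has_derivative (\<lambda>h. h \<bullet> D (x - y))) (at (x - y))"
    using assms unfolding C1_gradient_def gderiv_def by blast
  moreover have "((\<lambda>x. x - y) has_derivative (\<lambda>h. h)) (at x)"
    by (auto intro!: derivative_eq_intros)
  ultimately show "GDERIV (\<lambda>x. f (x - y)) x :> D (x - y)"
    unfolding gderiv_def using has_derivative_compose[of "\<lambda>x. x - y" "\<lambda>h. h" x UNIV f] by simp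
next
  have "continuous_on UNIV D" using assms unfolding C1_gradient_def by blast
  then show "continuous_on UNIV (\<lambda>x. D (x - y))"
    by (rule continuous_on_compose2) (auto intro!: continuous_intros)
qed

text \<open>
  The complement of a closed set is open, so \<open>f\<close> vanishes near every point outside \<open>S\<close>.
\<close>

lemma C1_gradient_zero_outside:
  assumes C1: "C1_gradient f D" and S: "closed S" and z: "\<And>x. x \<notin> S \<Longrightarrow> f x = 0" and x: "x \<notin> S"
  shows "D x = 0"
proof -
  have "(f has_derivative (\<lambda>h. h \<bullet> D x)) (at x)"
    using C1 unfolding C1_gradient_def gderiv_def by blast
  moreover have "(f has_derivative (\<lambda>h. 0)) (at x)"
    by (rule has_derivative_transform_within_open[of "\<lambda>x. 0" _ _ _ "- S"])
       (use S x z in \<open>auto simp: open_Compl\<close>)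
  ultimately have "(\<lambda>h. h \<bullet> D x) = (\<lambda>h. 0)" by (rule has_derivative_unique)
  then have "D x \<bullet> D x = 0" by meson
  then show ?thesis by simp
qed

lemma compact_support_bounded:
  fixes F :: "'a::euclidean_space \<Rightarrow> 'b::real_normed_vector"
  assumes F: "continuous_on UNIV F" and S: "compact S" and z: "\<And>x. x \<notin> S \<Longrightarrow> F x = 0"
  obtains B where "B > 0" "\<And>x. norm (F x) \<le> B"
proof -
  have "bounded (F ` S)"
    using compact_continuous_image[of S F] continuous_on_subset[OF F] S compact_imp_bounded by blast
  then obtain B where "B > 0" "\<forall>x\<in>S. norm (F x) \<le> B" unfolding bounded_pos by auto
  moreover then have "norm (F x) \<le> B" for x using z[of x] by (cases "x \<in> S") auto
  ultimately show ?thesis using that by blast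
qed

text \<open>
  A \<open>C\<^sup>1\<close> approximation of the Heaviside function that is exactly zero on the negative half-line;
  the square makes the positive part differentiable at \<open>0\<close>, and \<open>n\<close> controls the steepness.
\<close>

definition smooth_step :: "real \<Rightarrow> real \<Rightarrow> real" where
  "smooth_step n t = n * (max 0 t)\<^sup>2 / (1 + n * (max 0 t)\<^sup>2)"

lemma DERIV_pos_part_squared: "((\<lambda>t::real. (max 0 t)\<^sup>2) has_real_derivative 2 * max 0 t) (at t)"
proof -
  consider "t > 0" | "t < 0" | "t = 0" by linarith
  then show ?thesis
  proof cases
    case 1
    have "((\<lambda>t. t\<^sup>2) has_real_derivative 2 * max 0 t) (at t)"
      using 1 by (auto intro!: derivative_eq_intros)
    then show ?thesis
      by (rule has_field_derivative_transform_within_open[where S="{0<..}"]) (use 1 in auto)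
  next
    case 2
    have "((\<lambda>t. 0) has_real_derivative 2 * max 0 t) (at t)"
      using 2 by (auto intro!: derivative_eq_intros)
    then show ?thesis
      by (rule has_field_derivative_transform_within_open[where S="{..<0}"]) (use 2 in auto)
  next
    case 3
    have "((\<lambda>h::real. (max 0 h)\<^sup>2 / h) \<longlongrightarrow> 0) (at 0)"
    proof (rule Lim_null_comparison)
      show "\<forall>\<^sub>F h in at 0. norm ((max 0 h)\<^sup>2 / h) \<le> \<bar>h\<bar>"
        by (rule always_eventually) (auto simp: max_def power2_eq_square)
      show "((\<lambda>h::real. \<bar>h\<bar>) \<longlongrightarrow> 0) (at 0)"
        by (rule tendsto_rabs_zero) (rule tendsto_ident_at)
    qed
    then show ?thesis using 3 by (simp add: DERIV_def)
  qed
qed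

lemma smooth_step_deriv:
  assumes "n \<ge> 0"
  shows "(smooth_step n has_real_derivative 2 * n * max 0 t / (1 + n * (max 0 t)\<^sup>2)\<^sup>2) (at t)"
proof -
  have ne: "1 + n * (max 0 t)\<^sup>2 \<noteq> 0"
    using assms by (smt (verit) mult_nonneg_nonneg zero_le_power2)
  have "((\<lambda>t. n * (max 0 t)\<^sup>2) has_real_derivative n * (2 * max 0 t)) (at t)"
    by (rule DERIV_cmult[OF DERIV_pos_part_squared])
  note N = this
  have M: "((\<lambda>t. 1 + n * (max 0 t)\<^sup>2) has_real_derivative n * (2 * max 0 t)) (at t)"
    using DERIV_add[OF DERIV_const[of 1] N] by simp
  show ?thesis
    unfolding smooth_step_def
    by (rule DERIV_cong[OF DERIV_divide[OF N M ne]]) (simp add: power2_eq_square algebra_simps)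
qed

lemma smooth_step_bounds:
  assumes "n \<ge> 0" shows "0 \<le> smooth_step n t" "smooth_step n t \<le> 1"
  using assms by (auto simp: smooth_step_def field_simps add_pos_nonneg)

lemma smooth_step_pos:
  assumes "n > 0" "t > 0" shows "0 < smooth_step n t"
  using assms by (simp add: smooth_step_def add_pos_nonneg)

lemma smooth_step_nonpos: "t \<le> 0 \<Longrightarrow> smooth_step n t = 0"
  by (simp add: smooth_step_def)

lemma smooth_step_limit:
  "(\<lambda>n. smooth_step (real n) t) \<longlonglongrightarrow> (if t > 0 then 1 else 0)"
proof (cases "t > 0")
  case True
  have "(\<lambda>n. real n * t\<^sup>2 / (1 + real n * t\<^sup>2)) \<longlonglongrightarrow> 1"
  proof -
    have f: "filterlim (\<lambda>n. 1 + real n * t\<^sup>2) at_top sequentially"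
      using True by (intro filterlim_tendsto_add_at_top[OF tendsto_const]
          filterlim_at_top_mult_tendsto_pos[OF tendsto_const] filterlim_real_sequentially) auto
    have "(\<lambda>n. 1 - 1 / (1 + real n * t\<^sup>2)) \<longlonglongrightarrow> 1 - 0"
      by (intro tendsto_intros tendsto_divide_0[OF tendsto_const] filterlim_at_top_imp_at_infinity f)
    moreover have "1 - 1 / (1 + real n * t\<^sup>2) = real n * t\<^sup>2 / (1 + real n * t\<^sup>2)" for n
    proof -
      have "1 + real n * t\<^sup>2 > 0" by (simp add: add_pos_nonneg)
      then show ?thesis by (simp add: field_simps)
    qed
    ultimately show ?thesis by simp
  qed
  then show ?thesis using True by (simp add: smooth_step_def)
next
  case False
  then show ?thesis by (simp add: smooth_step_nonpos)
qed

text \<open>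
  For \<open>a \<le> b\<close> the factor of index \<open>i\<close> is positive exactly when \<open>x \<bullet> i\<close> lies strictly between
  \<open>a \<bullet> i\<close> and \<open>b \<bullet> i\<close>. One formula thus serves as a cut-off with compact support (fixed \<open>n\<close>) and, as
  \<open>n \<rightarrow> \<infinity>\<close>, as an approximation of the indicator of an open box.
\<close>

definition box_bump :: "real \<Rightarrow> 'a::euclidean_space \<Rightarrow> 'a \<Rightarrow> 'a \<Rightarrow> real" where
  "box_bump n a b x = (\<Prod>i\<in>Basis. smooth_step n ((x \<bullet> i - a \<bullet> i) * (b \<bullet> i - x \<bullet> i)))"

lemma box_bump_C1:
  assumes "n \<ge> 0" shows "\<exists>D. C1_gradient (box_bump n a b) D"
  unfolding box_bump_def[abs_def]
proof (rule C1_gradient_prod)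
  fix i :: 'a assume "i \<in> Basis"
  define q where "q = (\<lambda>x::'a. (x \<bullet> i - a \<bullet> i) * (b \<bullet> i - x \<bullet> i))"
  define q' where "q' = (\<lambda>x::'a. ((b \<bullet> i - x \<bullet> i) - (x \<bullet> i - a \<bullet> i)) *\<^sub>R i)"
  define s' where "s' = (\<lambda>t::real. 2 * n * max 0 t / (1 + n * (max 0 t)\<^sup>2)\<^sup>2)"
  have ne: "1 + n * (max 0 t)\<^sup>2 \<noteq> 0" for t
    using assms by (smt (verit) mult_nonneg_nonneg zero_le_power2)
  have q: "GDERIV q x :> q' x" for x
    unfolding gderiv_def q_def q'_def
    by (auto intro!: derivative_eq_intros simp: algebra_simps)
  have "GDERIV (\<lambda>x. smooth_step n (q x)) x :> s' (q x) *\<^sub>R q' x" for x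
    by (rule GDERIV_DERIV_compose[OF q]) (use smooth_step_deriv[OF assms] in \<open>simp add: s'_def\<close>)
  moreover have "continuous_on UNIV (\<lambda>x. s' (q x) *\<^sub>R q' x)"
    unfolding s'_def q_def q'_def using ne by (intro continuous_intros) auto
  ultimately show "\<exists>D. C1_gradient (\<lambda>x. smooth_step n ((x \<bullet> i - a \<bullet> i) * (b \<bullet> i - x \<bullet> i))) D"
    unfolding C1_gradient_def q_def by (intro exI[of _ "\<lambda>x. s' (q x) *\<^sub>R q' x"]) (simp add: q_def)
qed simp

lemma box_bump_bounds:
  assumes "n \<ge> 0" shows "0 \<le> box_bump n a b x" "box_bump n a b x \<le> 1"
  unfolding box_bump_def using smooth_step_bounds[OF assms]
  by (auto intro!: prod_nonneg prod_le_1)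

lemma between_iff_prod_pos:
  fixes s t r :: real
  assumes "s \<le> t" shows "(r - s) * (t - r) > 0 \<longleftrightarrow> s < r \<and> r < t"
  using assms by (auto simp: zero_less_mult_iff)

lemma box_bump_pos:
  assumes "n > 0" "x \<in> box a b"
  shows "box_bump n a b x > 0"
  unfolding box_bump_def
proof (rule prod_pos)
  fix i :: 'a assume "i \<in> Basis"
  then have "(x \<bullet> i - a \<bullet> i) * (b \<bullet> i - x \<bullet> i) > 0" using assms(2) by (auto simp: mem_box)
  then show "0 < smooth_step n ((x \<bullet> i - a \<bullet> i) * (b \<bullet> i - x \<bullet> i))"
    using smooth_step_pos[OF assms(1)] by blast
qed

lemma box_bump_zero:
  assumes ab: "\<And>i. i \<in> Basis \<Longrightarrow> a \<bullet> i \<le> b \<bullet> i" and x: "x \<notin> box a b"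
  shows "box_bump n a b x = 0"
proof -
  obtain i where i: "i \<in> Basis" "\<not> (a \<bullet> i < x \<bullet> i \<and> x \<bullet> i < b \<bullet> i)" using x by (auto simp: mem_box)
  then have "(x \<bullet> i - a \<bullet> i) * (b \<bullet> i - x \<bullet> i) \<le> 0" using between_iff_prod_pos[OF ab[OF i(1)]] by force
  then show ?thesis
    unfolding box_bump_def using i(1) by (intro prod_zero bexI[of _ i]) (auto simp: smooth_step_nonpos)
qed

lemma box_bump_limit:
  assumes ab: "\<And>i. i \<in> Basis \<Longrightarrow> a \<bullet> i \<le> b \<bullet> i"
  shows "(\<lambda>n. box_bump (real n) a b x) \<longlonglongrightarrow> indicator (box a b) x"
proof (cases "x \<in> box a b")
  case True
  have "(\<lambda>n. box_bump (real n) a b x) \<longlonglongrightarrow> (\<Prod>i\<in>(Basis::'a set). 1)"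
    unfolding box_bump_def
  proof (rule tendsto_prod)
    fix i :: 'a assume "i \<in> Basis"
    then have "(x \<bullet> i - a \<bullet> i) * (b \<bullet> i - x \<bullet> i) > 0" using True by (auto simp: mem_box)
    then show "(\<lambda>n. smooth_step (real n) ((x \<bullet> i - a \<bullet> i) * (b \<bullet> i - x \<bullet> i))) \<longlonglongrightarrow> 1"
      using smooth_step_limit[of "(x \<bullet> i - a \<bullet> i) * (b \<bullet> i - x \<bullet> i)"] by simp
  qed
  then show ?thesis using True by simp
next
  case False
  then show ?thesis by (simp add: box_bump_zero[OF ab])
qed

lemma box_bump_C1c_test:
  assumes "n \<ge> 0" "\<And>i. i \<in> Basis \<Longrightarrow> a \<bullet> i \<le> b \<bullet> i" "cbox a b \<subseteq> \<Omega>"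
  obtains D where "C1c_test \<Omega> (box_bump n a b) D"
proof -
  obtain D where "C1_gradient (box_bump n a b) D" using box_bump_C1[OF assms(1)] by blast
  moreover have "box_bump n a b x = 0" if "x \<notin> cbox a b" for x
    using box_bump_zero[OF assms(2)] that box_subset_cbox by blast
  ultimately show ?thesis using that assms(3) compact_cbox unfolding C1c_test_def C1_gradient_def by blast
qed

section \<open>Integration by parts\<close>

lemma borel_measurable_lebesgue_on_continuous:
  fixes f :: "'a::euclidean_space \<Rightarrow> 'b::euclidean_space"
  assumes "continuous_on UNIV f" shows "f \<in> borel_measurable (lebesgue_on S)"
  by (intro measurable_restrict_space1 measurable_completion)
     (use assms borel_measurable_continuous_onI in simp)

lemma finite_measure_lebesgue_on_open:
  fixes \<Omega> :: "'a::euclidean_space set"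
  assumes "open \<Omega>" "bounded \<Omega>" shows "finite_measure (lebesgue_on \<Omega>)"
  using assms finite_measure_lebesgue_on lmeasurable_open by blast

lemma C1_gradient_lipschitz:
  fixes f :: "'a::euclidean_space \<Rightarrow> real"
  assumes C1: "C1_gradient f D" and L: "\<And>x. norm (D x) \<le> L"
  shows "\<bar>f x - f y\<bar> \<le> L * norm (x - y)"
proof -
  have "norm (f x - f y) \<le> L * norm (x - y)"
  proof (rule differentiable_bound[of UNIV])
    fix z show "(f has_derivative (\<lambda>h. h \<bullet> D z)) (at z within UNIV)"
      using C1 unfolding C1_gradient_def gderiv_def by simp
    show "onorm (\<lambda>h. h \<bullet> D z) \<le> L"
    proof (rule onorm_le)
      fix h show "norm (h \<bullet> D z) \<le> L * norm h"
        using Cauchy_Schwarz_ineq2[of h "D z"] mult_right_mono[OF L[of z], of "norm h"]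
        by (simp add: mult.commute)
    qed
  qed auto
  then show ?thesis by simp
qed

text \<open>
  Differentiation under the integral sign: the difference quotients of \<open>\<rho>\<close> are bounded by
  \<open>L * norm w\<close>, so dominated convergence applies with the majorant \<open>L * norm w * norm (u z)\<close>. With
  \<open>u = 1\<close> on a large ball this gives the integration by parts formula, and with \<open>u\<close> in \<open>K\<close> it gives the Lipschitz bound.
\<close>

lemma integral_against_translates_deriv:
  fixes \<rho> :: "'a::euclidean_space \<Rightarrow> real"
  assumes u: "integrable (lebesgue_on S) u" and C1: "C1_gradient \<rho> D" and L: "\<And>x. norm (D x) \<le> L"
    and Lr: "\<And>x. \<bar>\<rho> x\<bar> \<le> B"
  shows "((\<lambda>t. \<integral>z. u z * \<rho> (z - x - t *\<^sub>R w) \<partial>lebesgue_on S) has_real_derivative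
     - (\<integral>z. u z * (D (z - x - t *\<^sub>R w) \<bullet> w) \<partial>lebesgue_on S)) (at t)"
proof -
  let ?M = "lebesgue_on S"
  note [measurable] = borel_measurable_integrable[OF u]
  have cont: "continuous_on UNIV \<rho>" "continuous_on UNIV D"
    using C1 C1_gradient_continuous unfolding C1_gradient_def by auto
  have mr [measurable]: "(\<lambda>z. \<rho> (z - x - s *\<^sub>R w)) \<in> borel_measurable ?M" for s
    by (intro borel_measurable_lebesgue_on_continuous continuous_on_compose2[OF cont(1)])
       (auto intro!: continuous_intros)
  have md [measurable]: "(\<lambda>z. D (z - x - s *\<^sub>R w)) \<in> borel_measurable ?M" for s
    by (intro borel_measurable_lebesgue_on_continuous continuous_on_compose2[OF cont(2)])
       (auto intro!: continuous_intros)
  have B: "B \<ge> 0" using Lr[of 0] by linarith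
  have ir: "integrable ?M (\<lambda>z. u z * \<rho> (z - x - s *\<^sub>R w))" for s
    by (rule Bochner_Integration.integrable_bound[OF integrable_mult_right[OF integrable_norm[OF u], of B]])
       (use Lr B in \<open>auto simp: abs_mult mult.commute[of "\<bar>u _\<bar>"] intro!: AE_I2 mult_right_mono\<close>)
  have lim: "(\<lambda>n. (\<integral>z. u z * (\<rho> (z - x - (t + X n) *\<^sub>R w) - \<rho> (z - x - t *\<^sub>R w)) / X n \<partial>?M))
          \<longlonglongrightarrow> (\<integral>z. u z * - (D (z - x - t *\<^sub>R w) \<bullet> w) \<partial>?M)"
    if X0: "\<And>n. X n \<noteq> 0" and X: "X \<longlonglongrightarrow> 0" for X :: "nat \<Rightarrow> real"
  proof (rule integral_dominated_convergence[where w="\<lambda>z. L * norm w * norm (u z)"])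
    show "integrable ?M (\<lambda>z. L * norm w * norm (u z))"
      using u by auto
    show "AE z in ?M. norm (u z * (\<rho> (z - x - (t + X n) *\<^sub>R w) - \<rho> (z - x - t *\<^sub>R w)) / X n)
             \<le> L * norm w * norm (u z)" for n
    proof (rule AE_I2)
      fix z
      have "\<bar>\<rho> (z - x - (t + X n) *\<^sub>R w) - \<rho> (z - x - t *\<^sub>R w)\<bar> \<le> L * norm (X n *\<^sub>R w)"
        using C1_gradient_lipschitz[OF C1 L, of "z - x - (t + X n) *\<^sub>R w" "z - x - t *\<^sub>R w"]
        by (simp add: algebra_simps norm_minus_commute)
      then have "\<bar>\<rho> (z - x - (t + X n) *\<^sub>R w) - \<rho> (z - x - t *\<^sub>R w)\<bar> / \<bar>X n\<bar> \<le> L * norm w"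
        using X0[of n] by (simp add: field_simps)
      from mult_left_mono[OF this, of "\<bar>u z\<bar>"]
      show "norm (u z * (\<rho> (z - x - (t + X n) *\<^sub>R w) - \<rho> (z - x - t *\<^sub>R w)) / X n)
             \<le> L * norm w * norm (u z)"
        by (simp add: abs_mult abs_divide mult.commute)
    qed
    show "AE z in ?M. (\<lambda>n. u z * (\<rho> (z - x - (t + X n) *\<^sub>R w) - \<rho> (z - x - t *\<^sub>R w)) / X n)
             \<longlonglongrightarrow> u z * - (D (z - x - t *\<^sub>R w) \<bullet> w)"
    proof (rule AE_I2)
      fix z
      have "((\<lambda>s. \<rho> (z - x - s *\<^sub>R w)) has_derivative (\<lambda>s. (- (s *\<^sub>R w)) \<bullet> D (z - x - t *\<^sub>R w))) (at t)"
      proof (rule has_derivative_compose[of "\<lambda>s. z - x - s *\<^sub>R w" "\<lambda>s. - (s *\<^sub>R w)" t UNIV \<rho>])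
        show "((\<lambda>s. z - x - s *\<^sub>R w) has_derivative (\<lambda>s. - (s *\<^sub>R w))) (at t)"
          by (auto intro!: derivative_eq_intros)
        show "(\<rho> has_derivative (\<lambda>h. h \<bullet> D (z - x - t *\<^sub>R w))) (at (z - x - t *\<^sub>R w))"
          using C1 unfolding C1_gradient_def gderiv_def by blast
      qed
      then have "((\<lambda>s. \<rho> (z - x - s *\<^sub>R w)) has_real_derivative - (D (z - x - t *\<^sub>R w) \<bullet> w)) (at t)"
        unfolding has_field_derivative_def by (rule has_derivative_eq_rhs) (auto simp: inner_commute)
      then have "((\<lambda>h. (\<rho> (z - x - (t + h) *\<^sub>R w) - \<rho> (z - x - t *\<^sub>R w)) / h) \<longlongrightarrow>
           - (D (z - x - t *\<^sub>R w) \<bullet> w)) (at 0)"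
        by (simp add: DERIV_def)
      then have "(\<lambda>n. (\<rho> (z - x - (t + X n) *\<^sub>R w) - \<rho> (z - x - t *\<^sub>R w)) / X n) \<longlonglongrightarrow>
           - (D (z - x - t *\<^sub>R w) \<bullet> w)"
        using X0 X unfolding tendsto_at_iff_sequentially by (auto simp: o_def)
      then show "(\<lambda>n. u z * (\<rho> (z - x - (t + X n) *\<^sub>R w) - \<rho> (z - x - t *\<^sub>R w)) / X n)
             \<longlonglongrightarrow> u z * - (D (z - x - t *\<^sub>R w) \<bullet> w)"
        using tendsto_mult_left by (fastforce simp: times_divide_eq_right[symmetric] simp del: times_divide_eq_right)
    qed
  qed measurable
  have eq: "((\<integral>z. u z * \<rho> (z - x - (t + h) *\<^sub>R w) \<partial>?M) - (\<integral>z. u z * \<rho> (z - x - t *\<^sub>R w) \<partial>?M)) / h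
      = (\<integral>z. u z * (\<rho> (z - x - (t + h) *\<^sub>R w) - \<rho> (z - x - t *\<^sub>R w)) / h \<partial>?M)" for h
    using ir[of "t + h"] ir[of t] by (simp add: right_diff_distrib)
  show ?thesis
    unfolding DERIV_def tendsto_at_iff_sequentially
    using lim by (auto simp: o_def eq)
qed

lemma integral_translate_supported:
  fixes f :: "'a::euclidean_space \<Rightarrow> real"
  assumes f: "continuous_on UNIV f" and T: "T \<in> sets lebesgue" and z: "\<And>x. x \<notin> T \<Longrightarrow> f (x - p) = 0"
  shows "(\<integral>x. f (x - p) \<partial>lebesgue_on T) = (\<integral>x. f x \<partial>lborel)"
proof -
  have [measurable]: "f \<in> borel_measurable borel"
    using borel_measurable_continuous_onI[OF f] .
  have "(\<integral>x. f (x - p) \<partial>lebesgue_on T) = (\<integral>x. indicator T x *\<^sub>R f (x - p) \<partial>lebesgue)"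
    using T by (subst integral_restrict_space) auto
  also have "\<dots> = (\<integral>x. f (x - p) \<partial>lebesgue)"
    by (intro Bochner_Integration.integral_cong) (auto simp: indicator_def z)
  also have "\<dots> = (\<integral>x. f (x - p) \<partial>lborel)"
    by (intro integral_completion) measurable
  also have "\<dots> = (\<integral>x. f (x - p) \<partial>distr lborel borel ((+) p))"
    by (simp add: lborel_distr_plus)
  also have "\<dots> = (\<integral>x. f (p + x - p) \<partial>lborel)"
    by (intro integral_distr) measurable
  finally show ?thesis by simp
qed

text \<open>
  The integral of \<open>f\<close> is invariant under translations in direction \<open>w\<close>; differentiating it in the
  translation parameter shows that the integral of the directional derivative \<open>D \<bullet> w\<close> vanishes.
\<close>

lemma integral_gradient_compact_support:
  fixes f :: "'a::euclidean_space \<Rightarrow> real"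
  assumes C1: "C1_gradient f D" and S: "compact S" and z: "\<And>x. x \<notin> S \<Longrightarrow> f x = 0"
    and \<Omega>: "S \<subseteq> \<Omega>" "\<Omega> \<in> sets lebesgue" "bounded \<Omega>"
  shows "(\<integral>x. D x \<partial>lebesgue_on \<Omega>) = 0"
proof -
  have contD: "continuous_on UNIV D" using C1 unfolding C1_gradient_def by blast
  have Dz: "D x = 0" if "x \<notin> S" for x
    using C1_gradient_zero_outside[OF C1 compact_imp_closed[OF S] z that] .
  obtain L where L: "L > 0" "\<And>x. norm (D x) \<le> L" using compact_support_bounded[OF contD S Dz] by blast
  obtain B where B: "B > 0" "\<And>x. norm (f x) \<le> B"
    using compact_support_bounded[OF C1_gradient_continuous[OF C1] S z] by blast
  obtain R where R: "R > 0" "S \<subseteq> ball 0 R"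
    using bounded_subset_ballD[OF compact_imp_bounded[OF S], of 0] by auto
  have int0: "(\<integral>x. D x \<bullet> w \<partial>lebesgue) = 0" for w
  proof (cases "w = 0")
    case False
    \<comment> \<open>A ball so large that the translates of f by t w with |t| < 1 are supported in it; on the whole
      space the constant function 1 would not be integrable.\<close>
    define T where "T = ball (0::'a) (R + norm w)"
    define h where "h = (\<lambda>t. \<integral>z. 1 * f (z - 0 - t *\<^sub>R w) \<partial>lebesgue_on T)"
    interpret finite_measure "lebesgue_on T"
      unfolding T_def by (rule finite_measure_lebesgue_on_open) auto
    have "(h has_real_derivative - (\<integral>z. 1 * (D (z - 0 - 0 *\<^sub>R w) \<bullet> w) \<partial>lebesgue_on T)) (at 0)"
      unfolding h_def using L(2) B(2) by (intro integral_against_translates_deriv[OF _ C1]) auto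
    then have d: "(h has_real_derivative - (\<integral>z. (D z \<bullet> w) \<partial>lebesgue_on T)) (at 0)" by simp
    have hconst: "h t = (\<integral>z. f z \<partial>lborel)" if "t \<in> {-1<..<1}" for t
    proof -
      have out: "f (z - t *\<^sub>R w) = 0" if "z \<notin> T" for z
      proof -
        have "norm (t *\<^sub>R w) \<le> norm w"
          using \<open>t \<in> {-1<..<1}\<close> by (auto intro!: mult_left_le_one_le)
        moreover have "norm z \<ge> R + norm w" using that by (simp add: T_def)
        ultimately have "norm (z - t *\<^sub>R w) \<ge> R" using norm_triangle_ineq2[of z "t *\<^sub>R w"] by linarith
        then show ?thesis using z R by (metis mem_ball_0 not_less subsetD)
      qed
      show ?thesis
        using integral_translate_supported[of f T "t *\<^sub>R w", OF C1_gradient_continuous[OF C1] _ out]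
        by (simp add: h_def) (simp add: T_def)
    qed
    have "(h has_real_derivative 0) (at 0)"
      by (rule has_field_derivative_transform_within_open[of "\<lambda>_. \<integral>z. f z \<partial>lborel" _ _ "{-1<..<1}"])
         (use hconst in auto)
    with d have "(\<integral>z. (D z \<bullet> w) \<partial>lebesgue_on T) = 0" using DERIV_unique by force
    moreover have "(\<integral>z. (D z \<bullet> w) \<partial>lebesgue_on T) = (\<integral>z. indicator T z *\<^sub>R (D z \<bullet> w) \<partial>lebesgue)"
      by (subst integral_restrict_space) (auto simp: T_def)
    moreover have "\<dots> = (\<integral>z. (D z \<bullet> w) \<partial>lebesgue)"
    proof (intro Bochner_Integration.integral_cong refl)
      fix z
      have "S \<subseteq> T" using R unfolding T_def by (auto simp: subset_eq) (smt (verit) norm_ge_zero)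
      then show "indicator T z *\<^sub>R (D z \<bullet> w) = D z \<bullet> w"
        using Dz[of z] by (cases "z \<in> S") (auto simp: subset_eq)
    qed
    ultimately show ?thesis by simp
  qed simp
  have "finite_measure (lebesgue_on \<Omega>)"
    using \<Omega> by (intro finite_measure_lebesgue_on bounded_set_imp_lmeasurable)
  then interpret finite_measure "lebesgue_on \<Omega>" .
  have iD: "integrable (lebesgue_on \<Omega>) D"
    using L by (intro integrable_const_bound[of _ L] borel_measurable_lebesgue_on_continuous[OF contD]) auto
  have "(\<integral>x. D x \<partial>lebesgue_on \<Omega>) \<bullet> w = 0" for w
  proof -
    have "(\<integral>x. D x \<partial>lebesgue_on \<Omega>) \<bullet> w = (\<integral>x. D x \<bullet> w \<partial>lebesgue_on \<Omega>)"
      using iD by simp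
    also have "\<dots> = (\<integral>x. indicator \<Omega> x *\<^sub>R (D x \<bullet> w) \<partial>lebesgue)"
      using \<Omega> by (subst integral_restrict_space) auto
    also have "\<dots> = (\<integral>x. D x \<bullet> w \<partial>lebesgue)"
      using \<Omega>(1) Dz by (intro Bochner_Integration.integral_cong) (auto simp: indicator_def subset_eq)
    finally show ?thesis using int0 by simp
  qed
  from this[of "\<integral>x. D x \<partial>lebesgue_on \<Omega>"] show ?thesis by simp
qed

text \<open>
  Integration by parts: \<open>v x * \<phi> x\<close> has compact support in \<open>\<Omega>\<close>, so its gradient has integral zero.
\<close>

lemma C1_gradient_is_weak_gradient:
  fixes v :: "'a::euclidean_space \<Rightarrow> real"
  assumes v: "C1_gradient v V" and \<Omega>: "open \<Omega>" "bounded \<Omega>"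
  shows "is_weak_gradient \<Omega> v V"
  unfolding is_weak_gradient_def
proof (intro allI impI)
  fix \<phi> D assume "C1c_test \<Omega> \<phi> D"
  then obtain S where \<phi>: "C1_gradient \<phi> D" and S: "compact S" "S \<subseteq> \<Omega>" "\<And>x. x \<notin> S \<Longrightarrow> \<phi> x = 0"
    unfolding C1c_test_def C1_gradient_def by blast
  have Dz: "D x = 0" if "x \<notin> S" for x
    using C1_gradient_zero_outside[OF \<phi> compact_imp_closed[OF S(1)] S(3) that] .
  have cont: "continuous_on UNIV v" "continuous_on UNIV V" "continuous_on UNIV \<phi>" "continuous_on UNIV D"
    using v \<phi> C1_gradient_continuous unfolding C1_gradient_def by blast+
  interpret finite_measure "lebesgue_on \<Omega>" by (rule finite_measure_lebesgue_on_open[OF \<Omega>])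
  have int: "integrable (lebesgue_on \<Omega>) F"
    if F: "continuous_on UNIV F" "\<And>x. x \<notin> S \<Longrightarrow> F x = 0" for F :: "'a \<Rightarrow> 'a"
  proof -
    obtain B where "\<And>x. norm (F x) \<le> B" using compact_support_bounded[OF F(1) S(1) F(2)] by blast
    then show ?thesis
      by (intro integrable_const_bound[of _ B] borel_measurable_lebesgue_on_continuous[OF F(1)]) auto
  qed
  have i1: "integrable (lebesgue_on \<Omega>) (\<lambda>x. v x *\<^sub>R D x)"
    using cont Dz by (intro int continuous_intros) auto
  have i2: "integrable (lebesgue_on \<Omega>) (\<lambda>x. \<phi> x *\<^sub>R V x)"
    using cont S by (intro int continuous_intros) auto
  have "(\<integral>x. v x *\<^sub>R D x + \<phi> x *\<^sub>R V x \<partial>lebesgue_on \<Omega>) = 0"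
    using \<Omega> S
    by (intro integral_gradient_compact_support[OF C1_gradient_mult[OF v \<phi>] S(1)]) auto
  then show "(\<integral>x. v x *\<^sub>R D x \<partial>lebesgue_on \<Omega>) = - (\<integral>x. \<phi> x *\<^sub>R V x \<partial>lebesgue_on \<Omega>)"
    using i1 i2 by (simp add: eq_neg_iff_add_eq_0)
qed

section \<open>Uniqueness of the weak gradient\<close>

lemma Linf_iff:
  fixes f :: "'a::euclidean_space \<Rightarrow> 'b::euclidean_space"
  shows "f \<in> Linf \<Omega> \<longleftrightarrow> f \<in> borel_measurable (lebesgue_on \<Omega>) \<and> (\<exists>B. AE x in lebesgue_on \<Omega>. norm (f x) \<le> B)"
proof
  assume f: "f \<in> Linf \<Omega>"
  then have m: "f \<in> borel_measurable (lebesgue_on \<Omega>)" and lt: "Linf_norm \<Omega> f < \<infinity>" by (auto simp: Linf_def)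
  have ae: "AE x in lebesgue_on \<Omega>. ereal (norm (f x)) \<le> Linf_norm \<Omega> f"
    unfolding Linf_norm_def by (rule esssup_AE)
  obtain B :: real where B: "Linf_norm \<Omega> f \<le> ereal B"
    using lt by (cases "Linf_norm \<Omega> f") auto
  have "AE x in lebesgue_on \<Omega>. norm (f x) \<le> B"
    using ae by eventually_elim (use B order_trans in fastforce)
  then show "f \<in> borel_measurable (lebesgue_on \<Omega>) \<and> (\<exists>B. AE x in lebesgue_on \<Omega>. norm (f x) \<le> B)"
    using m by blast
next
  assume "f \<in> borel_measurable (lebesgue_on \<Omega>) \<and> (\<exists>B. AE x in lebesgue_on \<Omega>. norm (f x) \<le> B)"
  then obtain B where m [measurable]: "f \<in> borel_measurable (lebesgue_on \<Omega>)"
    and B: "AE x in lebesgue_on \<Omega>. norm (f x) \<le> B" by blast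
  have "Linf_norm \<Omega> f \<le> ereal B"
    unfolding Linf_norm_def by (rule esssup_I) (use B in auto)
  then show "f \<in> Linf \<Omega>"
    unfolding Linf_def using m by (auto intro: le_less_trans)
qed

lemma Linf_norm_le_iff:
  fixes f :: "'a::euclidean_space \<Rightarrow> 'b::euclidean_space"
  assumes [measurable]: "f \<in> borel_measurable (lebesgue_on \<Omega>)"
  shows "Linf_norm \<Omega> f \<le> ereal B \<longleftrightarrow> (AE x in lebesgue_on \<Omega>. norm (f x) \<le> B)"
proof
  assume "Linf_norm \<Omega> f \<le> ereal B"
  moreover have "AE x in lebesgue_on \<Omega>. ereal (norm (f x)) \<le> Linf_norm \<Omega> f"
    unfolding Linf_norm_def by (rule esssup_AE)
  ultimately show "AE x in lebesgue_on \<Omega>. norm (f x) \<le> B"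
    by (auto elim!: eventually_mono dest: order_trans)
next
  assume "AE x in lebesgue_on \<Omega>. norm (f x) \<le> B"
  then show "Linf_norm \<Omega> f \<le> ereal B"
    unfolding Linf_norm_def by (intro esssup_I) auto
qed

text \<open>
  By Lebesgue's differentiation theorem \<open>f x\<close> is, for almost every \<open>x\<close>, the limit of the means of \<open>f\<close>
  over the cubes with lower corner \<open>x\<close>; small cubes of this kind are contained in \<open>\<Omega>\<close>.
\<close>

lemma AE_zero_if_integral_boxes_zero:
  fixes f :: "'a::euclidean_space \<Rightarrow> 'b::euclidean_space"
  assumes \<Omega>: "open \<Omega>" and f: "integrable (lebesgue_on \<Omega>) f"
    and z: "\<And>a b. cbox a b \<subseteq> \<Omega> \<Longrightarrow> (\<integral>x. indicator (box a b) x *\<^sub>R f x \<partial>lebesgue_on \<Omega>) = 0"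
  shows "AE x in lebesgue_on \<Omega>. f x = 0"
proof -
  define F where "F = (\<lambda>x. indicator \<Omega> x *\<^sub>R f x)"
  have s: "\<Omega> \<in> sets lebesgue" using \<Omega> by simp
  have F: "integrable lebesgue F"
    using f s unfolding F_def by (subst (asm) integrable_restrict_space) auto
  then have Fac: "F absolutely_integrable_on cbox a b" for a b
    unfolding set_integrable_def by (auto intro!: integrable_mult_indicator)
  obtain N where N: "negligible N"
    and lim: "\<And>x e. x \<notin> N \<Longrightarrow> 0 < e \<Longrightarrow> \<exists>d>0. \<forall>h. 0 < h \<and> h < d \<longrightarrow>
               norm (integral (cbox x (x + h *\<^sub>R One)) F /\<^sub>R h ^ DIM('a) - F x) < e"
    using integrable_ccontinuous_explicit[of F] Fac set_lebesgue_integral_eq_integral(1) by metis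
  have "F x = 0" if x: "x \<in> \<Omega>" "x \<notin> N" for x
  proof (rule ccontr)
    assume "F x \<noteq> 0"
    then obtain d where d: "d > 0" "\<And>h. 0 < h \<Longrightarrow> h < d \<Longrightarrow>
        norm (integral (cbox x (x + h *\<^sub>R One)) F /\<^sub>R h ^ DIM('a) - F x) < norm (F x)"
      using lim[OF x(2), of "norm (F x)"] by auto
    obtain r where r: "r > 0" "cball x r \<subseteq> \<Omega>" using \<Omega> x(1) open_contains_cball by blast
    define h where "h = min (d / 2) (r / (norm (One :: 'a) + 1))"
    have h: "h > 0" "h < d" "h * norm (One::'a) \<le> r"
    proof -
      have p: "norm (One::'a) + 1 > 0" by (simp add: add_nonneg_pos)
      show "h > 0" "h < d" using d(1) r(1) p by (auto simp: h_def)
      then have "h * norm (One::'a) \<le> h * (norm (One::'a) + 1)" by simp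
      also have "\<dots> \<le> r" using pos_le_divide_eq[OF p, of h r] by (simp add: h_def)
      finally show "h * norm (One::'a) \<le> r" .
    qed
    have sub: "cbox x (x + h *\<^sub>R One) \<subseteq> \<Omega>"
    proof
      fix y assume y: "y \<in> cbox x (x + h *\<^sub>R One)"
      have "norm (y - x) \<le> norm (h *\<^sub>R (One::'a))"
        using y h(1) by (intro norm_le_componentwise) (auto simp: mem_box inner_diff_left inner_add_left)
      then have "y \<in> cball x r" using h by (simp add: dist_norm norm_minus_commute)
      then show "y \<in> \<Omega>" using r(2) by blast
    qed
    have "integral (cbox x (x + h *\<^sub>R One)) F = integral (box x (x + h *\<^sub>R One)) F"
      by (rule integral_open_interval[symmetric])
    also have "\<dots> = (LINT y:box x (x + h *\<^sub>R One)|lebesgue. F y)"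
      using F by (intro set_lebesgue_integral_eq_integral(2)[symmetric])
                 (auto simp: set_integrable_def intro!: integrable_mult_indicator)
    also have "\<dots> = (\<integral>y. indicator (box x (x + h *\<^sub>R One)) y *\<^sub>R f y \<partial>lebesgue_on \<Omega>)"
      unfolding set_lebesgue_integral_def F_def using s
      by (subst integral_restrict_space) (auto simp: mult.commute)
    also have "\<dots> = 0" using z[OF sub] .
    finally show False using d(2)[OF h(1,2)] by simp
  qed
  then have "F x = 0" if "x \<notin> N" for x using that by (cases "x \<in> \<Omega>") (auto simp: F_def)
  then have F0: "AE x in lebesgue. F x = 0"
    using N by (intro AE_I'[of N]) (auto simp: negligible_iff_null_sets)
  show ?thesis
  proof (subst AE_restrict_space_iff)
    show "AE x in lebesgue. x \<in> \<Omega> \<longrightarrow> f x = 0"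
      using F0 by eventually_elim (auto simp: F_def)
  qed (use s in simp)
qed

text \<open>
  The fundamental lemma of the calculus of variations. The test functions \<open>box_bump n a b\<close> converge
  to the indicator of the box, so the integrals over all boxes in \<open>\<Omega>\<close> vanish.
\<close>

lemma AE_zero_if_orthogonal_to_tests:
  fixes V :: "'a::euclidean_space \<Rightarrow> 'b::euclidean_space"
  assumes \<Omega>: "open \<Omega>" "bounded \<Omega>" and V: "integrable (lebesgue_on \<Omega>) V"
    and z: "\<And>\<phi> D. C1c_test \<Omega> \<phi> D \<Longrightarrow> (\<integral>x. \<phi> x *\<^sub>R V x \<partial>lebesgue_on \<Omega>) = 0"
  shows "AE x in lebesgue_on \<Omega>. V x = 0"
proof (rule AE_zero_if_integral_boxes_zero[OF \<Omega>(1) V])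
  fix a b :: 'a assume sub: "cbox a b \<subseteq> \<Omega>"
  note [measurable] = borel_measurable_integrable[OF V]
  show "(\<integral>x. indicator (box a b) x *\<^sub>R V x \<partial>lebesgue_on \<Omega>) = 0"
  proof (cases "\<forall>i\<in>Basis. a \<bullet> i \<le> b \<bullet> i")
    case True
    have [measurable]: "box_bump (real n) a b \<in> borel_measurable (lebesgue_on \<Omega>)" for n
      using box_bump_C1[of "real n" a b] C1_gradient_continuous
      by (auto intro: borel_measurable_lebesgue_on_continuous)
    have [measurable]: "indicator (box a b) \<in> borel_measurable (lebesgue_on \<Omega>)"
      by (intro measurable_restrict_space1 borel_measurable_indicator) auto
    have "(\<lambda>n. \<integral>x. box_bump (real n) a b x *\<^sub>R V x \<partial>lebesgue_on \<Omega>)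
       \<longlonglongrightarrow> (\<integral>x. indicator (box a b) x *\<^sub>R V x \<partial>lebesgue_on \<Omega>)"
    proof (rule integral_dominated_convergence[where w="\<lambda>x. norm (V x)"])
      show "integrable (lebesgue_on \<Omega>) (\<lambda>x. norm (V x))" using V by simp
      show "AE x in lebesgue_on \<Omega>. (\<lambda>n. box_bump (real n) a b x *\<^sub>R V x) \<longlonglongrightarrow> indicator (box a b) x *\<^sub>R V x"
        by (intro AE_I2 tendsto_scaleR tendsto_const box_bump_limit) (use True in auto)
      show "AE x in lebesgue_on \<Omega>. norm (box_bump (real n) a b x *\<^sub>R V x) \<le> norm (V x)" for n
        using box_bump_bounds[of "real n" a b] by (auto intro!: AE_I2 mult_left_le_one_le)
    qed measurable
    moreover have "(\<integral>x. box_bump (real n) a b x *\<^sub>R V x \<partial>lebesgue_on \<Omega>) = 0" for n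
      using box_bump_C1c_test[of "real n" a b \<Omega>] True sub z by (metis of_nat_0_le_iff)
    ultimately show ?thesis by (simp add: LIMSEQ_const_iff)
  next
    case False
    then have "box a b = {}" by (force simp: box_eq_empty not_le)
    then show ?thesis by simp
  qed
qed

text \<open>
  The definition of \<open>wgrad\<close> chooses some weak gradient; uniqueness makes it possible to
  bound \<open>wgrad\<close> by exhibiting any weak gradient at all, which is how membership in \<open>K\<close> is proved below.
\<close>

lemma weak_gradient_unique:
  fixes u :: "'a::euclidean_space \<Rightarrow> real"
  assumes \<Omega>: "open \<Omega>" "bounded \<Omega>" and V: "V \<in> Linf \<Omega>" "is_weak_gradient \<Omega> u V"
    and W: "W \<in> Linf \<Omega>" "is_weak_gradient \<Omega> u W"
  shows "AE x in lebesgue_on \<Omega>. V x = W x"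
proof -
  interpret finite_measure "lebesgue_on \<Omega>" by (rule finite_measure_lebesgue_on_open[OF \<Omega>])
  have int: "integrable (lebesgue_on \<Omega>) X" if "X \<in> Linf \<Omega>" for X :: "'a \<Rightarrow> 'a"
    using that unfolding Linf_iff by (auto intro: integrable_const_bound)
  have "AE x in lebesgue_on \<Omega>. V x - W x = 0"
  proof (rule AE_zero_if_orthogonal_to_tests[OF \<Omega>])
    show "integrable (lebesgue_on \<Omega>) (\<lambda>x. V x - W x)" using int V W by auto
    fix \<phi> D assume t: "C1c_test \<Omega> \<phi> D"
    then obtain S where \<phi>: "C1_gradient \<phi> D" and S: "compact S" "\<And>x. x \<notin> S \<Longrightarrow> \<phi> x = 0"
      unfolding C1c_test_def C1_gradient_def by blast
    have c: "continuous_on UNIV \<phi>" by (rule C1_gradient_continuous[OF \<phi>])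
    obtain B where B: "B > 0" "\<And>x. norm (\<phi> x) \<le> B" using compact_support_bounded[OF c S] by blast
    note [measurable] = borel_measurable_lebesgue_on_continuous[OF c]
    have i: "integrable (lebesgue_on \<Omega>) (\<lambda>x. \<phi> x *\<^sub>R X x)" if "X \<in> Linf \<Omega>" for X :: "'a \<Rightarrow> 'a"
    proof (rule Bochner_Integration.integrable_bound[of _ "\<lambda>x. B *\<^sub>R norm (X x)"])
      note [measurable] = borel_measurable_integrable[OF int[OF that]]
      show "(\<lambda>x. \<phi> x *\<^sub>R X x) \<in> borel_measurable (lebesgue_on \<Omega>)" by measurable
      show "integrable (lebesgue_on \<Omega>) (\<lambda>x. B *\<^sub>R norm (X x))" using int[OF that] by simp
      show "AE x in lebesgue_on \<Omega>. norm (\<phi> x *\<^sub>R X x) \<le> norm (B *\<^sub>R norm (X x))"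
        using B by (auto intro!: AE_I2 mult_right_mono)
    qed
    have "(\<integral>x. \<phi> x *\<^sub>R (V x - W x) \<partial>lebesgue_on \<Omega>) =
        (\<integral>x. \<phi> x *\<^sub>R V x \<partial>lebesgue_on \<Omega>) - (\<integral>x. \<phi> x *\<^sub>R W x \<partial>lebesgue_on \<Omega>)"
      using i V W by (simp add: scaleR_diff_right)
    also have "\<dots> = 0"
    proof -
      have "(\<integral>x. u x *\<^sub>R D x \<partial>lebesgue_on \<Omega>) = - (\<integral>x. \<phi> x *\<^sub>R V x \<partial>lebesgue_on \<Omega>)"
        "(\<integral>x. u x *\<^sub>R D x \<partial>lebesgue_on \<Omega>) = - (\<integral>x. \<phi> x *\<^sub>R W x \<partial>lebesgue_on \<Omega>)"
        using V(2) W(2) t unfolding is_weak_gradient_def by blast+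
      then show ?thesis by simp
    qed
    finally show "(\<integral>x. \<phi> x *\<^sub>R (V x - W x) \<partial>lebesgue_on \<Omega>) = 0" .
  qed
  then show ?thesis by simp
qed

lemma wgrad_spec:
  assumes "u \<in> W1inf \<Omega>"
  shows "wgrad \<Omega> u \<in> Linf \<Omega>" "is_weak_gradient \<Omega> u (wgrad \<Omega> u)"
proof -
  have "\<exists>V. V \<in> Linf \<Omega> \<and> is_weak_gradient \<Omega> u V" using assms by (auto simp: W1inf_def)
  from someI_ex[OF this] show "wgrad \<Omega> u \<in> Linf \<Omega>" "is_weak_gradient \<Omega> u (wgrad \<Omega> u)"
    unfolding wgrad_def by auto
qed

lemma K_setD:
  assumes "u \<in> K_set \<Omega>"
  shows "continuous_on (closure \<Omega>) u" "u \<in> borel_measurable (lebesgue_on \<Omega>)"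
    "wgrad \<Omega> u \<in> borel_measurable (lebesgue_on \<Omega>)" "is_weak_gradient \<Omega> u (wgrad \<Omega> u)"
    "AE x in lebesgue_on \<Omega>. norm (wgrad \<Omega> u x) \<le> 1"
proof -
  have W: "u \<in> W1inf \<Omega>" and 1: "Linf_norm \<Omega> (wgrad \<Omega> u) \<le> 1"
    using assms by (auto simp: K_set_def)
  show "continuous_on (closure \<Omega>) u" using assms by (auto simp: K_set_def C_closure_def)
  show "u \<in> borel_measurable (lebesgue_on \<Omega>)" using W by (auto simp: W1inf_def Linf_def)
  show m: "wgrad \<Omega> u \<in> borel_measurable (lebesgue_on \<Omega>)" and "is_weak_gradient \<Omega> u (wgrad \<Omega> u)"
    using wgrad_spec[OF W] by (auto simp: Linf_def)
  show "AE x in lebesgue_on \<Omega>. norm (wgrad \<Omega> u x) \<le> 1"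
    using 1 Linf_norm_le_iff[OF m, of 1] by (simp add: one_ereal_def)
qed

lemma K_setI:
  fixes u :: "'a::euclidean_space \<Rightarrow> real"
  assumes \<Omega>: "open \<Omega>" "bounded \<Omega>" and c: "continuous_on (closure \<Omega>) u"
    and V: "V \<in> borel_measurable (lebesgue_on \<Omega>)" "is_weak_gradient \<Omega> u V"
      "AE x in lebesgue_on \<Omega>. norm (V x) \<le> 1"
  shows "u \<in> K_set \<Omega>"
proof -
  have Vl: "V \<in> Linf \<Omega>" using V unfolding Linf_iff by blast
  have mu: "u \<in> borel_measurable (lebesgue_on \<Omega>)"
    using continuous_on_subset[OF c closure_subset] \<Omega> by (intro continuous_imp_measurable_on_sets_lebesgue) auto
  have "bounded (u ` closure \<Omega>)"
    using c \<Omega>(2) by (intro compact_imp_bounded compact_continuous_image) (auto simp: compact_closure)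
  then obtain B where "\<And>x. x \<in> closure \<Omega> \<Longrightarrow> norm (u x) \<le> B" by (auto simp: bounded_iff)
  then have "AE x in lebesgue_on \<Omega>. norm (u x) \<le> B"
    using closure_subset by (intro AE_I2) (auto simp: subset_eq)
  then have "u \<in> Linf \<Omega>" using mu unfolding Linf_iff by blast
  then have W: "u \<in> W1inf \<Omega>" using Vl V(2) unfolding W1inf_def by blast
  note w = wgrad_spec[OF W]
  have "AE x in lebesgue_on \<Omega>. wgrad \<Omega> u x = V x"
    by (rule weak_gradient_unique[OF \<Omega> w Vl V(2)])
  with V(3) have "AE x in lebesgue_on \<Omega>. norm (wgrad \<Omega> u x) \<le> 1"
    by eventually_elim simp
  then have "Linf_norm \<Omega> (wgrad \<Omega> u) \<le> 1"
    using w(1) Linf_norm_le_iff[of "wgrad \<Omega> u" \<Omega> 1] by (auto simp: Linf_def one_ereal_def)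
  then show ?thesis using W c unfolding K_set_def C_closure_def by blast
qed

section \<open>Elements of K are Lipschitz with constant 1\<close>

lemma C1c_test_bounded:
  fixes \<phi> :: "'a::euclidean_space \<Rightarrow> real"
  assumes "C1c_test \<Omega> \<phi> D"
  obtains B where "B > 0" "\<And>x. \<bar>\<phi> x\<bar> \<le> B" "\<And>x. norm (D x) \<le> B"
    "\<phi> \<in> borel_measurable (lebesgue_on \<Omega>)" "D \<in> borel_measurable (lebesgue_on \<Omega>)"
proof -
  obtain S where \<phi>: "C1_gradient \<phi> D" and S: "compact S" "\<And>x. x \<notin> S \<Longrightarrow> \<phi> x = 0"
    using assms unfolding C1c_test_def C1_gradient_def by blast
  have cont: "continuous_on UNIV \<phi>" "continuous_on UNIV D"
    using \<phi> C1_gradient_continuous unfolding C1_gradient_def by blast+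
  obtain B where B: "B > 0" "\<And>x. norm (\<phi> x) \<le> B" using compact_support_bounded[OF cont(1) S] by blast
  obtain C where C: "C > 0" "\<And>x. norm (D x) \<le> C"
    using compact_support_bounded[OF cont(2) S(1)] C1_gradient_zero_outside[OF \<phi> compact_imp_closed[OF S(1)] S(2)]
    by blast
  show ?thesis
  proof (rule that[of "max B C"])
    show "\<bar>\<phi> x\<bar> \<le> max B C" "norm (D x) \<le> max B C" for x
      using B(2)[of x] C(2)[of x] by auto
  qed (use B borel_measurable_lebesgue_on_continuous[OF cont(1)]
       borel_measurable_lebesgue_on_continuous[OF cont(2)] in auto)
qed

text \<open>
  A nonempty open set has positive measure.
\<close>

lemma integral_pos_if_pos_on_open:
  fixes F :: "'a::euclidean_space \<Rightarrow> real"
  assumes F: "integrable (lebesgue_on \<Omega>) F" and nn: "\<And>x. x \<in> \<Omega> \<Longrightarrow> F x \<ge> 0"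
    and \<Omega>: "\<Omega> \<in> sets lebesgue" and U: "open U" "U \<noteq> {}" "U \<subseteq> \<Omega>" "\<And>x. x \<in> U \<Longrightarrow> F x > 0"
  shows "(\<integral>x. F x \<partial>lebesgue_on \<Omega>) > 0"
proof (rule ccontr)
  assume "\<not> ?thesis"
  moreover have "(\<integral>x. F x \<partial>lebesgue_on \<Omega>) \<ge> 0"
    using nn by (intro integral_nonneg_AE AE_I2) auto
  ultimately have "(\<integral>x. F x \<partial>lebesgue_on \<Omega>) = 0" by linarith
  then have "AE x in lebesgue_on \<Omega>. F x = 0"
    using nn by (subst (asm) integral_nonneg_eq_0_iff_AE[OF F]) (auto intro!: AE_I2)
  then have "AE x in lebesgue. x \<in> \<Omega> \<longrightarrow> F x = 0"
    using \<Omega> by (simp add: AE_restrict_space_iff)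
  then have "AE x in lebesgue. x \<notin> U"
    by eventually_elim (use U in fastforce)
  then have "negligible U"
    using U(1) by (simp add: negligible_iff_null_sets AE_iff_null_sets)
  then show False using open_not_negligible U by blast
qed

text \<open>
  The bump of the cube with centre \<open>0\<close> and half-width \<open>\<delta> / (norm One + 1)\<close>, which the ball of radius
  \<open>\<delta>\<close> contains. Its translates serve as averaging kernels and as comparison function.
\<close>

lemma small_box_bump:
  fixes \<delta> :: real
  assumes "\<delta> > 0"
  obtains \<rho> :: "'a::euclidean_space \<Rightarrow> real" and D where "C1_gradient \<rho> D" "\<And>x. \<rho> x \<ge> 0" "\<rho> 0 > 0"
    "\<And>x. x \<notin> cball 0 \<delta> \<Longrightarrow> \<rho> x = 0"
proof -
  define e where "e = \<delta> / (norm (One::'a) + 1)"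
  have p: "norm (One::'a) + 1 > 0" by (simp add: add_nonneg_pos)
  have e: "e > 0" "e * norm (One::'a) \<le> \<delta>"
    using assms p by (auto simp: e_def field_simps)
  define \<rho> where "\<rho> = box_bump 1 (- e *\<^sub>R One) (e *\<^sub>R (One::'a))"
  obtain D where D: "C1_gradient \<rho> D" using box_bump_C1[of 1] unfolding \<rho>_def by auto
  have "0 \<in> box (- e *\<^sub>R One) (e *\<^sub>R (One::'a))" using e by (auto simp: mem_box)
  then have p0: "\<rho> 0 > 0" unfolding \<rho>_def by (rule box_bump_pos[rotated]) simp
  have out: "\<rho> x = 0" if "x \<notin> cball 0 \<delta>" for x
    unfolding \<rho>_def
  proof (rule box_bump_zero)
    show "x \<notin> box (- e *\<^sub>R One) (e *\<^sub>R (One::'a))"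
    proof
      assume x: "x \<in> box (- e *\<^sub>R One) (e *\<^sub>R (One::'a))"
      have "norm x \<le> norm (e *\<^sub>R (One::'a))"
        using x e by (intro norm_le_componentwise) (force simp: mem_box abs_le_iff)
      then show False using that e by simp
    qed
  qed (use e in auto)
  show ?thesis
    by (rule that[OF D _ p0 out]) (simp_all add: \<rho>_def box_bump_bounds)
qed

lemma K_set_integrable:
  assumes "open \<Omega>" "bounded \<Omega>" "u \<in> K_set \<Omega>"
  shows "integrable (lebesgue_on \<Omega>) u"
proof -
  interpret finite_measure "lebesgue_on \<Omega>" by (rule finite_measure_lebesgue_on_open[OF assms(1,2)])
  have "bounded (u ` closure \<Omega>)"
    using K_setD(1)[OF assms(3)] assms(2)
    by (intro compact_imp_bounded compact_continuous_image) (auto simp: compact_closure)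
  then obtain B where "\<And>x. x \<in> closure \<Omega> \<Longrightarrow> norm (u x) \<le> B" by (auto simp: bounded_iff)
  then show ?thesis
    using closure_subset K_setD(2)[OF assms(3)]
    by (intro integrable_const_bound[of _ B] AE_I2) (auto simp: subset_eq)
qed

text \<open>
  Put \<open>w = y - x\<close> and let \<open>h t\<close> be the integral of \<open>u\<close> against the bump \<open>\<rho>\<close> moved to the point \<open>x + t w\<close>.
  Then \<open>h' t\<close> is, up to sign, the integral of \<open>u\<close> against the derivative of a test function, hence
  by definition of the weak gradient it is the integral of \<open>V \<bullet> w\<close> against the bump, and
  \<open>norm V \<le> 1\<close> gives \<open>h' t \<le> norm w * c\<close>, where \<open>c\<close> is the integral of \<open>\<rho>\<close>. As \<open>h 0\<close> and \<open>h 1\<close> are close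
  to \<open>c * u x\<close> and \<open>c * u y\<close> for a narrow bump, the bound follows. This replaces a mollification of
  \<open>u\<close> on all of \<open>\<Omega>\<close> by one along the segment.
\<close>

lemma K_set_difference_bound:
  fixes u :: "'a::euclidean_space \<Rightarrow> real"
  assumes \<Omega>: "open \<Omega>" "bounded \<Omega>" and u: "u \<in> K_set \<Omega>"
    and seg: "closed_segment x y \<subseteq> \<Omega>"
  shows "u y - u x \<le> norm (y - x)"
proof (rule field_le_epsilon)
  fix e :: real assume e: "e > 0"
  define \<eta> where "\<eta> = e / 2"
  have \<eta>: "\<eta> > 0" using e by (simp add: \<eta>_def)
  define w where "w = y - x"
  have pt: "x + t *\<^sub>R w \<in> closed_segment x y" if "0 \<le> t" "t \<le> 1" for t
    using that unfolding closed_segment_def w_def by (auto simp: algebra_simps intro!: exI[of _ t])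
  \<comment> \<open>The segment has positive distance from the complement, so narrow bumps centred on it are
    test functions.\<close>
  have "\<exists>\<delta>>0. \<forall>p\<in>closed_segment x y. \<forall>q\<in>- \<Omega>. \<delta> \<le> dist p q"
    using seg \<Omega> by (intro separate_compact_closed) auto
  then obtain \<delta>0 where \<delta>0: "\<delta>0 > 0" "\<And>p q. p \<in> closed_segment x y \<Longrightarrow> q \<notin> \<Omega> \<Longrightarrow> \<delta>0 \<le> dist p q" by blast
  have close: "\<exists>\<delta>>0. \<forall>z\<in>\<Omega>. dist z p < \<delta> \<longrightarrow> \<bar>u z - u p\<bar> < \<eta>" if "p \<in> \<Omega>" for p
    using continuous_on_subset[OF K_setD(1)[OF u] closure_subset] that \<eta>
    unfolding continuous_on_iff dist_real_def by blast
  have xy: "x \<in> \<Omega>" "y \<in> \<Omega>" using seg by auto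
  obtain \<delta>1 where \<delta>1: "\<delta>1 > 0" "\<And>z. z \<in> \<Omega> \<Longrightarrow> dist z x < \<delta>1 \<Longrightarrow> \<bar>u z - u x\<bar> < \<eta>" using close[OF xy(1)] by blast
  obtain \<delta>2 where \<delta>2: "\<delta>2 > 0" "\<And>z. z \<in> \<Omega> \<Longrightarrow> dist z y < \<delta>2 \<Longrightarrow> \<bar>u z - u y\<bar> < \<eta>" using close[OF xy(2)] by blast
  define \<delta> where "\<delta> = min \<delta>0 (min \<delta>1 \<delta>2) / 2"
  have \<delta>: "\<delta> > 0" "\<delta> < \<delta>0" "\<delta> < \<delta>1" "\<delta> < \<delta>2" using \<delta>0(1) \<delta>1(1) \<delta>2(1) by (auto simp: \<delta>_def)
  obtain \<rho> :: "'a \<Rightarrow> real" and D where \<rho>: "C1_gradient \<rho> D" "\<And>x. \<rho> x \<ge> 0" "\<rho> 0 > 0"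
    "\<And>x. x \<notin> cball 0 \<delta> \<Longrightarrow> \<rho> x = 0"
    using small_box_bump[OF \<delta>(1)] by blast
  have c\<rho>: "continuous_on UNIV \<rho>" "continuous_on UNIV D"
    using \<rho>(1) C1_gradient_continuous unfolding C1_gradient_def by blast+
  have Dz: "D z = 0" if "z \<notin> cball 0 \<delta>" for z
    by (rule C1_gradient_zero_outside[OF \<rho>(1) closed_cball \<rho>(4) that])
  obtain L where L: "L > 0" "\<And>z. norm (D z) \<le> L" using compact_support_bounded[OF c\<rho>(2) compact_cball Dz] by blast
  obtain B where B: "B > 0" "\<And>z. norm (\<rho> z) \<le> B" using compact_support_bounded[OF c\<rho>(1) compact_cball \<rho>(4)] by blast
  let ?M = "lebesgue_on \<Omega>"
  interpret finite_measure ?M by (rule finite_measure_lebesgue_on_open[OF \<Omega>])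
  define V where "V = wgrad \<Omega> u"
  have V: "V \<in> borel_measurable ?M" "is_weak_gradient \<Omega> u V" "AE z in ?M. norm (V z) \<le> 1"
    using K_setD[OF u] unfolding V_def by auto
  note [measurable] = V(1) K_setD(2)[OF u]
  have iu: "integrable ?M u" by (rule K_set_integrable[OF \<Omega> u])
  have m [measurable]: "(\<lambda>z. \<rho> (z - p)) \<in> borel_measurable ?M" "(\<lambda>z. D (z - p)) \<in> borel_measurable ?M" for p
    using C1_gradient_translate[OF \<rho>(1), of p] C1_gradient_continuous unfolding C1_gradient_def
    by (blast intro: borel_measurable_lebesgue_on_continuous C1_gradient_continuous[OF C1_gradient_translate[OF \<rho>(1)]])+
  have i\<rho>: "integrable ?M (\<lambda>z. \<rho> (z - p))" for p
    using B by (intro integrable_const_bound[of _ B]) auto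
  have iu\<rho>: "integrable ?M (\<lambda>z. u z * \<rho> (z - p))" for p
  proof (rule Bochner_Integration.integrable_bound[of _ "\<lambda>z. B * norm (u z)"])
    show "AE z in ?M. norm (u z * \<rho> (z - p)) \<le> norm (B * norm (u z))"
      using B by (auto simp: abs_mult mult.commute[of "\<bar>u _\<bar>"] intro!: AE_I2 mult_right_mono)
  qed (use iu in auto)
  have iuD: "integrable ?M (\<lambda>z. u z *\<^sub>R D (z - p))" for p
  proof (rule Bochner_Integration.integrable_bound[of _ "\<lambda>z. L * norm (u z)"])
    show "AE z in ?M. norm (u z *\<^sub>R D (z - p)) \<le> norm (L * norm (u z))"
      using L by (auto simp: abs_mult mult.commute[of "\<bar>u _\<bar>"] intro!: AE_I2 mult_right_mono)
  qed (use iu in auto)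
  have i\<rho>V: "integrable ?M (\<lambda>z. \<rho> (z - p) *\<^sub>R V z)" for p
  proof (rule integrable_const_bound[of _ B])
    show "AE z in ?M. norm (\<rho> (z - p) *\<^sub>R V z) \<le> B"
      using V(3)
    proof eventually_elim
      case (elim z)
      have "\<bar>\<rho> (z - p)\<bar> * norm (V z) \<le> B * 1"
        using B(2)[of "z - p"] elim B(1) by (intro mult_mono) auto
      then show ?case by simp
    qed
  qed auto
  define c where "c = (\<integral>z. \<rho> z \<partial>lborel)"
  have near: "z \<in> \<Omega>" if "p \<in> closed_segment x y" "\<rho> (z - p) \<noteq> 0" for z p
  proof (rule ccontr)
    assume "z \<notin> \<Omega>"
    then show False
      using \<rho>(4)[of "z - p"] that \<delta>0(2)[of p z] \<delta>(2) by (auto simp: dist_norm norm_minus_commute)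
  qed
  have c: "(\<integral>z. \<rho> (z - p) \<partial>?M) = c" if "p \<in> closed_segment x y" for p
    unfolding c_def using near[OF that] \<Omega> by (intro integral_translate_supported[OF c\<rho>(1)]) auto
  have cpos: "c > 0"
  proof -
    have "(\<integral>z. \<rho> (z - x) \<partial>?M) > 0"
    proof (rule integral_pos_if_pos_on_open[OF i\<rho>, of _ "{z. \<rho> (z - x) > 0}"])
      show "open {z. \<rho> (z - x) > 0}"
        by (intro open_Collect_less continuous_on_compose2[OF c\<rho>(1)] continuous_intros) auto
      show "{z. \<rho> (z - x) > 0} \<noteq> {}" using \<rho>(3) by (auto intro!: exI[of _ x])
      show "{z. \<rho> (z - x) > 0} \<subseteq> \<Omega>" using near[of x] by auto
    qed (use \<rho>(2) \<Omega> in auto)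
    then show ?thesis using c[of x] by simp
  qed
  define h where "h = (\<lambda>t. \<integral>z. u z * \<rho> (z - x - t *\<^sub>R w) \<partial>?M)"
  have hd: "(h has_real_derivative - (\<integral>z. u z * (D (z - x - t *\<^sub>R w) \<bullet> w) \<partial>?M)) (at t)" for t
    unfolding h_def
    by (rule integral_against_translates_deriv[OF iu \<rho>(1) L(2), of B]) (use B in auto)
  have hd_le: "- (\<integral>z. u z * (D (z - x - t *\<^sub>R w) \<bullet> w) \<partial>?M) \<le> norm w * c" if "0 \<le> t" "t \<le> 1" for t
  proof -
    define p where "p = x + t *\<^sub>R w"
    have p: "p \<in> closed_segment x y" using pt[OF that] by (simp add: p_def)
    have "C1c_test \<Omega> (\<lambda>z. \<rho> (z - p)) (\<lambda>z. D (z - p))"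
      unfolding C1c_test_def
    proof (intro conjI exI[of _ "cball p \<delta>"])
      show "\<forall>z. GDERIV (\<lambda>z. \<rho> (z - p)) z :> D (z - p)" "continuous_on UNIV (\<lambda>z. D (z - p))"
        using C1_gradient_translate[OF \<rho>(1), of p] unfolding C1_gradient_def by auto
      show "cball p \<delta> \<subseteq> \<Omega>"
      proof
        fix q assume q: "q \<in> cball p \<delta>"
        show "q \<in> \<Omega>" using \<delta>0(2)[OF p, of q] q \<delta>(2) by (rule_tac ccontr) auto
      qed
      show "\<forall>z. z \<notin> cball p \<delta> \<longrightarrow> \<rho> (z - p) = 0"
        using \<rho>(4) by (auto simp: dist_norm norm_minus_commute)
    qed auto
    then have wk: "(\<integral>z. u z *\<^sub>R D (z - p) \<partial>?M) = - (\<integral>z. \<rho> (z - p) *\<^sub>R V z \<partial>?M)"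
      using V(2) unfolding is_weak_gradient_def by blast
    have "- (\<integral>z. u z * (D (z - x - t *\<^sub>R w) \<bullet> w) \<partial>?M) = - (\<integral>z. (u z *\<^sub>R D (z - p)) \<bullet> w \<partial>?M)"
      by (simp add: p_def diff_diff_eq)
    also have "\<dots> = (\<integral>z. (\<rho> (z - p) *\<^sub>R V z) \<bullet> w \<partial>?M)"
      using wk iuD[of p] i\<rho>V[of p] by (simp only: integral_inner_left) simp
    also have "\<dots> \<le> (\<integral>z. norm w * \<rho> (z - p) \<partial>?M)"
    proof (rule integral_mono_AE)
      show "integrable ?M (\<lambda>z. (\<rho> (z - p) *\<^sub>R V z) \<bullet> w)" using i\<rho>V[of p] by (rule integrable_inner_left)
      show "integrable ?M (\<lambda>z. norm w * \<rho> (z - p))" using i\<rho> by simp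
      show "AE z in ?M. (\<rho> (z - p) *\<^sub>R V z) \<bullet> w \<le> norm w * \<rho> (z - p)"
        using V(3)
      proof eventually_elim
        case (elim z)
        have "V z \<bullet> w \<le> 1 * norm w"
          using norm_cauchy_schwarz[of "V z" w] mult_right_mono[OF elim, of "norm w"] by simp
        from mult_left_mono[OF this \<rho>(2)[of "z - p"]] show ?case by (simp add: mult.commute)
      qed
    qed
    also have "\<dots> = norm w * c" using c[OF p] by simp
    finally show ?thesis .
  qed
  obtain t where "0 < t" "t < 1" "h 1 - h 0 = (1 - 0) * - (\<integral>z. u z * (D (z - x - t *\<^sub>R w) \<bullet> w) \<partial>?M)"
    using MVT2[of 0 1 h, OF _ hd] by auto
  then have hle: "h 1 - h 0 \<le> norm w * c" using hd_le[of t] by simp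
  \<comment> \<open>Averages against the bump are close to point values, by continuity of u at p.\<close>
  have avg: "\<bar>(\<integral>z. u z * \<rho> (z - p) \<partial>?M) - u p * c\<bar> \<le> \<eta> * c"
    if p: "p \<in> closed_segment x y" and cl: "\<And>z. z \<in> \<Omega> \<Longrightarrow> dist z p \<le> \<delta> \<Longrightarrow> \<bar>u z - u p\<bar> < \<eta>" for p
  proof -
    have "(\<integral>z. u z * \<rho> (z - p) \<partial>?M) - u p * c = (\<integral>z. (u z - u p) * \<rho> (z - p) \<partial>?M)"
      using iu\<rho>[of p] i\<rho>[of p] c[OF p] by (simp add: left_diff_distrib)
    also have "\<bar>\<dots>\<bar> \<le> (\<integral>z. \<eta> * \<rho> (z - p) \<partial>?M)"
    proof -
      have "norm (\<integral>z. (u z - u p) * \<rho> (z - p) \<partial>?M) \<le> (\<integral>z. \<eta> * \<rho> (z - p) \<partial>?M)"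
      proof (rule Bochner_Integration.integral_norm_bound_integral)
        show "integrable ?M (\<lambda>z. (u z - u p) * \<rho> (z - p))"
          using iu\<rho>[of p] i\<rho>[of p] by (simp add: left_diff_distrib)
        fix z assume z: "z \<in> space ?M"
        show "norm ((u z - u p) * \<rho> (z - p)) \<le> \<eta> * \<rho> (z - p)"
        proof (cases "dist z p \<le> \<delta>")
          case True
          then have "\<bar>u z - u p\<bar> \<le> \<eta>" using cl[of z] z by simp
          then show ?thesis using \<rho>(2)[of "z - p"] by (simp add: abs_mult mult_right_mono)
        next
          case False
          then show ?thesis using \<rho>(4)[of "z - p"] by (simp add: dist_norm norm_minus_commute)
        qed
      qed (use i\<rho> in auto)
      then show ?thesis by simp
    qed
    also have "\<dots> = \<eta> * c" using c[OF p] by simp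
    finally show ?thesis .
  qed
  have "\<bar>h 0 - u x * c\<bar> \<le> \<eta> * c"
    using avg[of x] \<delta>1 \<delta>(3) by (simp add: h_def)
  moreover have "\<bar>h 1 - u y * c\<bar> \<le> \<eta> * c"
    using avg[of y] \<delta>2 \<delta>(4) by (simp add: h_def w_def)
  ultimately have "u y * c - u x * c \<le> norm w * c + 2 * \<eta> * c" using hle by linarith
  then have "(u y - u x) * c \<le> (norm w + 2 * \<eta>) * c" by (simp add: algebra_simps)
  then show "u y - u x \<le> norm (y - x) + e" using cpos by (simp add: w_def \<eta>_def)
qed

lemma K_set_lipschitz:
  fixes u :: "'a::euclidean_space \<Rightarrow> real"
  assumes \<Omega>: "open \<Omega>" "bounded \<Omega>" "convex \<Omega>" and u: "u \<in> K_set \<Omega>"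
  shows "1-lipschitz_on (closure \<Omega>) u"
proof (rule lipschitz_on_closure[OF lipschitz_onI K_setD(1)[OF u]])
  fix x y assume xy: "x \<in> \<Omega>" "y \<in> \<Omega>"
  have "closed_segment x y \<subseteq> \<Omega>" "closed_segment y x \<subseteq> \<Omega>"
    using \<Omega>(3) xy by (auto simp: closed_segment_subset)
  from K_set_difference_bound[OF \<Omega>(1,2) u this(1)] K_set_difference_bound[OF \<Omega>(1,2) u this(2)]
  show "dist (u x) (u y) \<le> 1 * dist x y" by (simp add: dist_norm norm_minus_commute abs_le_iff)
qed simp

section \<open>K is closed under uniform convergence\<close>

text \<open>
  The integral of the sum is finite, so the sum is finite almost everywhere.
\<close>

lemma AE_summable_if_integrals_summable:
  fixes f :: "nat \<Rightarrow> 'a \<Rightarrow> real"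
  assumes f: "\<And>k. integrable M (f k)" and nn: "\<And>k x. f k x \<ge> 0"
    and le: "\<And>k. (\<integral>x. f k x \<partial>M) \<le> b k" and b: "summable b"
  shows "AE x in M. summable (\<lambda>k. f k x)"
proof -
  have [measurable]: "f k \<in> borel_measurable M" for k using f by auto
  have b0: "b k \<ge> 0" for k
  proof -
    have "0 \<le> (\<integral>x. f k x \<partial>M)" by (intro integral_nonneg_AE AE_I2 nn)
    then show ?thesis using le[of k] by linarith
  qed
  have "(\<integral>\<^sup>+x. (\<Sum>k. ennreal (f k x)) \<partial>M) = (\<Sum>k. \<integral>\<^sup>+x. ennreal (f k x) \<partial>M)"
    by (rule nn_integral_suminf) measurable
  also have "\<dots> \<le> (\<Sum>k. ennreal (b k))"
  proof (rule suminf_le)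
    show "(\<integral>\<^sup>+x. ennreal (f k x) \<partial>M) \<le> ennreal (b k)" for k
      using le[of k] nn by (subst nn_integral_eq_integral[OF f]) (auto simp: ennreal_leI)
  qed auto
  also have "\<dots> = ennreal (\<Sum>k. b k)" using b b0 by (simp add: suminf_ennreal2)
  also have "\<dots> < \<infinity>" by simp
  finally have "AE x in M. (\<Sum>k. ennreal (f k x)) \<noteq> \<infinity>"
    by (intro nn_integral_PInf_AE) auto
  then show ?thesis
    by eventually_elim (use nn in \<open>auto intro: summable_suminf_not_top\<close>)
qed

text \<open>
  Since \<open>r \<le> (1/2)\<^sup>k + 2\<^sup>k r\<^sup>2\<close> for \<open>r \<ge> 0\<close>, the norms of the increments are dominated by a geometric
  series plus a series whose integrals are at most \<open>c * (1/4)\<^sup>k\<close>. This inequality takes the place of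
  the Cauchy--Schwarz inequality for passing from \<open>L\<^sup>2\<close> to \<open>L\<^sup>1\<close>.
\<close>

lemma AE_convergent_if_L2_steps_small:
  fixes W :: "nat \<Rightarrow> 'a \<Rightarrow> 'b::euclidean_space"
  assumes int: "\<And>k. integrable M (\<lambda>x. (norm (W (Suc k) x - W k x))\<^sup>2)"
    and le: "\<And>k. (\<integral>x. (norm (W (Suc k) x - W k x))\<^sup>2 \<partial>M) \<le> c * (1/8) ^ k"
  shows "AE x in M. convergent (\<lambda>k. W k x)"
proof -
  have "AE x in M. summable (\<lambda>k. 2 ^ k * (norm (W (Suc k) x - W k x))\<^sup>2)"
  proof (rule AE_summable_if_integrals_summable[where b="\<lambda>k. c * (1/4) ^ k"])
    show "integrable M (\<lambda>x. 2 ^ k * (norm (W (Suc k) x - W k x))\<^sup>2)" for k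
      using int by simp
    show "(\<integral>x. 2 ^ k * (norm (W (Suc k) x - W k x))\<^sup>2 \<partial>M) \<le> c * (1/4) ^ k" for k
    proof -
      have "(\<integral>x. 2 ^ k * (norm (W (Suc k) x - W k x))\<^sup>2 \<partial>M) \<le> 2 ^ k * (c * (1/8) ^ k)"
        using le[of k] by simp
      also have "\<dots> = c * (1/4) ^ k" by (simp add: power_mult_distrib[symmetric] mult.left_commute)
      finally show ?thesis .
    qed
    show "summable (\<lambda>k. c * (1/4) ^ k)" by (intro summable_mult summable_geometric) simp
  qed simp
  then show ?thesis
  proof eventually_elim
    case (elim x)
    have "summable (\<lambda>k. (1/2) ^ k + 2 ^ k * (norm (W (Suc k) x - W k x))\<^sup>2)"
      by (intro summable_add elim summable_geometric) simp
    then have "summable (\<lambda>k. W (Suc k) x - W k x)"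
    proof (rule summable_comparison_test'[of _ 0])
      fix k :: nat
      define r where "r = norm (W (Suc k) x - W k x)"
      have pp: "(1/2) ^ k * 2 ^ k = (1::real)" by (simp add: power_mult_distrib[symmetric])
      have "0 \<le> 2 ^ k * (r - (1/2) ^ k)\<^sup>2" by simp
      also have "\<dots> = 2 ^ k * r\<^sup>2 - 2 * r * ((1/2) ^ k * 2 ^ k) + (1/2) ^ k * ((1/2) ^ k * 2 ^ k)"
        by (simp add: power2_eq_square algebra_simps)
      finally have "2 * r \<le> 2 ^ k * r\<^sup>2 + (1/2) ^ k" unfolding pp by simp
      moreover have "r \<ge> 0" by (simp add: r_def)
      ultimately show "norm (W (Suc k) x - W k x) \<le> (1/2) ^ k + 2 ^ k * (norm (W (Suc k) x - W k x))\<^sup>2"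
        unfolding r_def by linarith
    qed
    then have "(\<lambda>n. \<Sum>k<n. W (Suc k) x - W k x) \<longlonglongrightarrow> (\<Sum>k. W (Suc k) x - W k x)"
      by (rule summable_LIMSEQ)
    then have "(\<lambda>n. W n x - W 0 x) \<longlonglongrightarrow> (\<Sum>k. W (Suc k) x - W k x)"
      by (subst (asm) sum_lessThan_telescope[of "\<lambda>k. W k x"])
    then have "(\<lambda>n. (W n x - W 0 x) + W 0 x) \<longlonglongrightarrow> (\<Sum>k. W (Suc k) x - W k x) + W 0 x"
      by (intro tendsto_add tendsto_const)
    then show ?case by (auto simp: convergent_def)
  qed
qed

text \<open>
  A substitute for weak compactness in \<open>L\<^sup>2\<close> that yields convergence almost everywhere. Let \<open>d n\<close> be the infimum over \<open>C n\<close> of the squared \<open>L\<^sup>2\<close>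
  norms. These infima increase to a finite limit \<open>l\<close>, and if \<open>V\<close>, \<open>W\<close> in \<open>C m\<close> have squared norms close
  to \<open>l\<close>, then so does their midpoint, because it belongs to \<open>C m\<close> and \<open>d m\<close> is close to \<open>l\<close>; the
  parallelogram identity then makes \<open>V - W\<close> small. Nearly minimal elements, chosen with error
  \<open>(1/8)\<^sup>k\<close>, therefore have small increments and converge almost everywhere.
\<close>

lemma midpoint_convex_selection_AE_convergent:
  fixes C :: "nat \<Rightarrow> ('a \<Rightarrow> 'b::euclidean_space) set"
  assumes fin: "finite_measure M" and dec: "decseq C" and ne: "\<And>n. C n \<noteq> {}"
    and meas: "\<And>n W. W \<in> C n \<Longrightarrow> W \<in> borel_measurable M"
    and bd: "\<And>n W. W \<in> C n \<Longrightarrow> AE x in M. norm (W x) \<le> B"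
    and mid: "\<And>n V W. V \<in> C n \<Longrightarrow> W \<in> C n \<Longrightarrow> (\<lambda>x. (1/2) *\<^sub>R (V x + W x)) \<in> C n"
  shows "\<exists>W. (\<forall>k. W k \<in> C k) \<and> (AE x in M. convergent (\<lambda>k. W k x))"
proof -
  interpret finite_measure M by fact
  define q where "q = (\<lambda>W :: 'a \<Rightarrow> 'b. \<integral>x. (norm (W x))\<^sup>2 \<partial>M)"
  have int: "integrable M (\<lambda>x. (norm (W x))\<^sup>2)" if "W \<in> C n" for W n
  proof (rule integrable_const_bound[of _ "B\<^sup>2"])
    show "AE x in M. norm ((norm (W x))\<^sup>2) \<le> B\<^sup>2"
      using bd[OF that] by eventually_elim (simp add: power_mono)
    note [measurable] = meas[OF that]
    show "(\<lambda>x. (norm (W x))\<^sup>2) \<in> borel_measurable M" by measurable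
  qed
  have q0: "q W \<ge> 0" for W by (simp add: q_def)
  have qle: "q W \<le> B\<^sup>2 * measure M (space M)" if "W \<in> C n" for W n
  proof -
    have "q W \<le> (\<integral>x. B\<^sup>2 \<partial>M)"
      unfolding q_def
    proof (rule integral_mono_AE[OF int[OF that]])
      show "AE x in M. (norm (W x))\<^sup>2 \<le> B\<^sup>2"
        using bd[OF that] by eventually_elim (simp add: power_mono)
    qed simp
    then show ?thesis by (simp add: mult.commute)
  qed
  define d where "d = (\<lambda>n. Inf (q ` C n))"
  have bb: "bdd_below (q ` C n)" for n using q0 by (auto intro!: bdd_belowI[of _ 0])
  have dle: "d n \<le> q W" if "W \<in> C n" for n W
    unfolding d_def using bb that by (auto intro: cInf_lower)
  have inc: "incseq d"
    unfolding d_def incseq_def using dec ne bb by (auto intro!: cInf_superset_mono image_mono simp: decseq_def)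
  have dbd: "d n \<le> B\<^sup>2 * measure M (space M)" for n
    using ne[of n] dle qle by (meson ex_in_conv order_trans)
  define l where "l = lim d"
  have dl: "d \<longlonglongrightarrow> l"
    using incseq_convergent[OF inc, of "B\<^sup>2 * measure M (space M)"] dbd unfolding l_def by (metis limI)
  have dlel: "d n \<le> l" for n by (rule incseq_le[OF inc dl])
  have "\<exists>n\<ge>k. l - (1/8) ^ k < d n" for k :: nat
  proof -
    have "\<forall>\<^sub>F n in sequentially. l - (1/8) ^ k < d n"
      using dl by (rule order_tendstoD) simp
    then have "\<forall>\<^sub>F n in sequentially. l - (1/8) ^ k < d n \<and> n \<ge> k"
      using eventually_ge_at_top by (rule eventually_conj)
    then show ?thesis using eventually_happens by fastforce
  qed
  then obtain n where n: "\<And>k. n k \<ge> k" "\<And>k. l - (1/8) ^ k < d (n k)" by metis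
  have "\<exists>W\<in>C (n k). q W < d (n k) + (1/8) ^ k" for k
    using cInf_lessD[of "q ` C (n k)" "d (n k) + (1/8) ^ k"] ne unfolding d_def by auto
  then obtain W where W: "\<And>k. W k \<in> C (n k)" "\<And>k. q (W k) < d (n k) + (1/8) ^ k" by metis
  have qW: "q (W k) \<le> l + (1/8) ^ k" for k using W(2)[of k] dlel[of "n k"] by linarith
  have step: "integrable M (\<lambda>x. (norm (W (Suc k) x - W k x))\<^sup>2) \<and>
      (\<integral>x. (norm (W (Suc k) x - W k x))\<^sup>2 \<partial>M) \<le> 8 * (1/8) ^ k" for k
  proof -
    \<comment> \<open>The indices n k need not increase; both functions belong to C m for the smaller index m.\<close>
    define m where "m = min (n k) (n (Suc k))"
    have "l - (1/8) ^ k \<le> d m"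
    proof (cases "n k \<le> n (Suc k)")
      case True then show ?thesis using n(2)[of k] by (simp add: m_def)
    next
      case False
      moreover have "(1/8) ^ Suc k \<le> ((1/8) ^ k :: real)" by simp
      moreover have "m = n (Suc k)" using False by (simp add: m_def)
      ultimately show ?thesis using n(2)[of "Suc k"] by (simp only:)
    qed
    moreover have sub: "C (n k) \<subseteq> C m" "C (n (Suc k)) \<subseteq> C m"
      using dec by (auto simp: m_def decseq_def)
    define Z where "Z = (\<lambda>x. (1/2) *\<^sub>R (W (Suc k) x + W k x))"
    have ZC: "Z \<in> C m" unfolding Z_def using W(1) sub by (intro mid) auto
    ultimately have qZ: "l - (1/8) ^ k \<le> q Z" using dle[OF ZC] by linarith
    have par: "(norm (W (Suc k) x - W k x))\<^sup>2 =
        2 * (norm (W (Suc k) x))\<^sup>2 + 2 * (norm (W k x))\<^sup>2 - 4 * (norm (Z x))\<^sup>2" for x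
      unfolding Z_def power2_norm_eq_inner by (simp add: algebra_simps inner_commute)
    note i = int[OF W(1)[of "Suc k"]] int[OF W(1)[of k]] int[OF ZC]
    have "integrable M (\<lambda>x. (norm (W (Suc k) x - W k x))\<^sup>2)" unfolding par using i by auto
    moreover have "(\<integral>x. (norm (W (Suc k) x - W k x))\<^sup>2 \<partial>M) = 2 * q (W (Suc k)) + 2 * q (W k) - 4 * q Z"
      unfolding par q_def using i by simp
    moreover have "(1/8) ^ Suc k \<le> ((1/8) ^ k :: real)" by simp
    ultimately show ?thesis using qW[of k] qW[of "Suc k"] qZ by linarith
  qed
  have "AE x in M. convergent (\<lambda>k. W k x)"
    using step by (intro AE_convergent_if_L2_steps_small) auto
  moreover have "W k \<in> C k" for k
    using W(1)[of k] dec n(1)[of k] by (auto simp: decseq_def)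
  ultimately show ?thesis by blast
qed

lemma is_weak_gradient_midpoint:
  fixes v w :: "'a::euclidean_space \<Rightarrow> real"
  assumes int: "integrable (lebesgue_on \<Omega>) v" "integrable (lebesgue_on \<Omega>) w"
      "integrable (lebesgue_on \<Omega>) V" "integrable (lebesgue_on \<Omega>) W"
    and V: "is_weak_gradient \<Omega> v V" and W: "is_weak_gradient \<Omega> w W"
  shows "is_weak_gradient \<Omega> (\<lambda>x. (v x + w x) / 2) (\<lambda>x. (1/2) *\<^sub>R (V x + W x))"
  unfolding is_weak_gradient_def
proof (intro allI impI)
  fix \<phi> D assume t: "C1c_test \<Omega> \<phi> D"
  obtain B where B: "B > 0" "\<And>x. \<bar>\<phi> x\<bar> \<le> B" "\<And>x. norm (D x) \<le> B"
    and [measurable]: "\<phi> \<in> borel_measurable (lebesgue_on \<Omega>)" "D \<in> borel_measurable (lebesgue_on \<Omega>)"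
    using C1c_test_bounded[OF t] by blast
  have i1: "integrable (lebesgue_on \<Omega>) (\<lambda>x. u x *\<^sub>R D x)" if u: "integrable (lebesgue_on \<Omega>) u" for u :: "'a \<Rightarrow> real"
  proof (rule Bochner_Integration.integrable_bound[of _ "\<lambda>x. B * norm (u x)"])
    show "AE x in lebesgue_on \<Omega>. norm (u x *\<^sub>R D x) \<le> norm (B * norm (u x))"
      using B by (auto simp: abs_mult mult.commute[of "\<bar>u _\<bar>"] intro!: AE_I2 mult_right_mono)
  qed (use u in auto)
  have i2: "integrable (lebesgue_on \<Omega>) (\<lambda>x. \<phi> x *\<^sub>R U x)" if U: "integrable (lebesgue_on \<Omega>) U" for U :: "'a \<Rightarrow> 'a"
  proof (rule Bochner_Integration.integrable_bound[of _ "\<lambda>x. B * norm (U x)"])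
    show "AE x in lebesgue_on \<Omega>. norm (\<phi> x *\<^sub>R U x) \<le> norm (B * norm (U x))"
      using B by (auto simp: abs_mult intro!: AE_I2 mult_right_mono)
  qed (use U in auto)
  have "(\<integral>x. ((v x + w x) / 2) *\<^sub>R D x \<partial>lebesgue_on \<Omega>) =
      (\<integral>x. (1/2) *\<^sub>R (v x *\<^sub>R D x + w x *\<^sub>R D x) \<partial>lebesgue_on \<Omega>)"
    by (intro Bochner_Integration.integral_cong refl)
       (simp add: scaleR_add_right scaleR_add_left add_divide_distrib)
  also have "\<dots> = (1/2) *\<^sub>R ((\<integral>x. v x *\<^sub>R D x \<partial>lebesgue_on \<Omega>) + (\<integral>x. w x *\<^sub>R D x \<partial>lebesgue_on \<Omega>))"
    using i1 int by (simp del: scaleR_half_double)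
  also have "\<dots> = - ((1/2) *\<^sub>R ((\<integral>x. \<phi> x *\<^sub>R V x \<partial>lebesgue_on \<Omega>) + (\<integral>x. \<phi> x *\<^sub>R W x \<partial>lebesgue_on \<Omega>)))"
  proof -
    have "(\<integral>x. v x *\<^sub>R D x \<partial>lebesgue_on \<Omega>) = - (\<integral>x. \<phi> x *\<^sub>R V x \<partial>lebesgue_on \<Omega>)"
      "(\<integral>x. w x *\<^sub>R D x \<partial>lebesgue_on \<Omega>) = - (\<integral>x. \<phi> x *\<^sub>R W x \<partial>lebesgue_on \<Omega>)"
      using V W t unfolding is_weak_gradient_def by blast+
    then show ?thesis by (simp add: algebra_simps)
  qed
  also have "\<dots> = - (\<integral>x. (1/2) *\<^sub>R (\<phi> x *\<^sub>R V x + \<phi> x *\<^sub>R W x) \<partial>lebesgue_on \<Omega>)"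
    using i2 int by simp
  also have "(\<lambda>x. (1/2) *\<^sub>R (\<phi> x *\<^sub>R V x + \<phi> x *\<^sub>R W x)) = (\<lambda>x. \<phi> x *\<^sub>R (1/2) *\<^sub>R (V x + W x))"
    by (auto simp: algebra_simps)
  finally show "(\<integral>x. ((v x + w x) / 2) *\<^sub>R D x \<partial>lebesgue_on \<Omega>) =
      - (\<integral>x. \<phi> x *\<^sub>R (1/2) *\<^sub>R (V x + W x) \<partial>lebesgue_on \<Omega>)" .
qed

lemma weak_gradient_AE_limit:
  fixes u :: "'a::euclidean_space \<Rightarrow> real"
  assumes fin: "finite_measure (lebesgue_on \<Omega>)"
    and m: "\<And>k. w k \<in> borel_measurable (lebesgue_on \<Omega>)" "\<And>k. W k \<in> borel_measurable (lebesgue_on \<Omega>)"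
      "u \<in> borel_measurable (lebesgue_on \<Omega>)" "V \<in> borel_measurable (lebesgue_on \<Omega>)"
    and wg: "\<And>k. is_weak_gradient \<Omega> (w k) (W k)"
    and bw: "\<And>k x. x \<in> \<Omega> \<Longrightarrow> \<bar>w k x\<bar> \<le> A" and bW: "\<And>k. AE x in lebesgue_on \<Omega>. norm (W k x) \<le> B"
    and lw: "\<And>x. x \<in> \<Omega> \<Longrightarrow> (\<lambda>k. w k x) \<longlonglongrightarrow> u x"
    and lW: "AE x in lebesgue_on \<Omega>. (\<lambda>k. W k x) \<longlonglongrightarrow> V x"
  shows "is_weak_gradient \<Omega> u V"
  unfolding is_weak_gradient_def
proof (intro allI impI)
  fix \<phi> D assume t: "C1c_test \<Omega> \<phi> D"
  obtain C where C: "C > 0" "\<And>x. \<bar>\<phi> x\<bar> \<le> C" "\<And>x. norm (D x) \<le> C"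
    and [measurable]: "\<phi> \<in> borel_measurable (lebesgue_on \<Omega>)" "D \<in> borel_measurable (lebesgue_on \<Omega>)"
    using C1c_test_bounded[OF t] by blast
  note [measurable] = m
  interpret finite_measure "lebesgue_on \<Omega>" by fact
  have "(\<lambda>k. \<integral>x. w k x *\<^sub>R D x \<partial>lebesgue_on \<Omega>) \<longlonglongrightarrow> (\<integral>x. u x *\<^sub>R D x \<partial>lebesgue_on \<Omega>)"
  proof (rule integral_dominated_convergence[where w="\<lambda>_. A * C"])
    show "AE x in lebesgue_on \<Omega>. norm (w k x *\<^sub>R D x) \<le> A * C" for k
      using bw[of _ k] C by (intro AE_I2) (auto intro!: mult_mono dest: order_trans[OF abs_ge_zero])
    show "AE x in lebesgue_on \<Omega>. (\<lambda>k. w k x *\<^sub>R D x) \<longlonglongrightarrow> u x *\<^sub>R D x"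
      using lw by (intro AE_I2 tendsto_scaleR tendsto_const) auto
  qed auto
  moreover have "(\<lambda>k. - (\<integral>x. \<phi> x *\<^sub>R W k x \<partial>lebesgue_on \<Omega>)) \<longlonglongrightarrow> - (\<integral>x. \<phi> x *\<^sub>R V x \<partial>lebesgue_on \<Omega>)"
  proof (rule tendsto_minus, rule integral_dominated_convergence[where w="\<lambda>_. C * B"])
    show "AE x in lebesgue_on \<Omega>. norm (\<phi> x *\<^sub>R W k x) \<le> C * B" for k
      using bW[of k] by eventually_elim (use C in \<open>auto intro!: mult_mono dest: order_trans[OF norm_ge_zero]\<close>)
    show "AE x in lebesgue_on \<Omega>. (\<lambda>k. \<phi> x *\<^sub>R W k x) \<longlonglongrightarrow> \<phi> x *\<^sub>R V x"
      using lW by eventually_elim (intro tendsto_scaleR tendsto_const)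
  qed auto
  moreover have "(\<integral>x. w k x *\<^sub>R D x \<partial>lebesgue_on \<Omega>) = - (\<integral>x. \<phi> x *\<^sub>R W k x \<partial>lebesgue_on \<Omega>)" for k
    using wg t unfolding is_weak_gradient_def by blast
  ultimately show "(\<integral>x. u x *\<^sub>R D x \<partial>lebesgue_on \<Omega>) = - (\<integral>x. \<phi> x *\<^sub>R V x \<partial>lebesgue_on \<Omega>)"
    using LIMSEQ_unique by fastforce
qed

text \<open>
  The gradients of \<open>un\<close> need not converge, but suitable convex combinations do. Let \<open>C n\<close> be the set of
  all weak gradients, bounded by 1, of functions within \<open>1 / (n + 1)\<close> of \<open>u\<close>. These sets are nonempty,
  decreasing and closed under midpoints, so one can select an element of each of them such that the
  selected sequence converges almost everywhere; its limit is a weak gradient of \<open>u\<close>.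
\<close>

lemma K_set_closed_uniform_limit:
  fixes u :: "'a::euclidean_space \<Rightarrow> real"
  assumes \<Omega>: "open \<Omega>" "bounded \<Omega>" and un: "\<And>n. un n \<in> K_set \<Omega>"
    and lim: "uniform_limit (closure \<Omega>) un u sequentially"
  shows "u \<in> K_set \<Omega>"
proof -
  let ?M = "lebesgue_on \<Omega>"
  have fin: "finite_measure ?M" by (rule finite_measure_lebesgue_on_open[OF \<Omega>])
  then interpret finite_measure ?M .
  have cu: "continuous_on (closure \<Omega>) u"
    by (rule uniform_limit_theorem[OF _ lim]) (use K_setD(1)[OF un] in auto)
  have mu [measurable]: "u \<in> borel_measurable ?M"
    using continuous_on_subset[OF cu closure_subset] \<Omega> by (intro continuous_imp_measurable_on_sets_lebesgue) auto
  have "bounded (u ` closure \<Omega>)"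
    using cu \<Omega>(2) by (intro compact_imp_bounded compact_continuous_image) (auto simp: compact_closure)
  then obtain A where A: "\<And>x. x \<in> closure \<Omega> \<Longrightarrow> norm (u x) \<le> A" by (auto simp: bounded_iff)
  define P where "P = (\<lambda>n w W. w \<in> borel_measurable ?M \<and> W \<in> borel_measurable ?M \<and>
     (AE x in ?M. norm (W x) \<le> 1) \<and> is_weak_gradient \<Omega> w W \<and> (\<forall>x\<in>\<Omega>. \<bar>w x - u x\<bar> \<le> 1 / real (Suc n)))"
  define C where "C = (\<lambda>n. {W. \<exists>w. P n w W})"
  have Pbd: "\<bar>w x\<bar> \<le> A + 1" if "P n w W" "x \<in> \<Omega>" for n w W x
  proof -
    have "\<bar>w x - u x\<bar> \<le> 1 / real (Suc n)" using that unfolding P_def by blast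
    also have "\<dots> \<le> 1" by simp
    finally show ?thesis using A[of x] that(2) closure_subset by fastforce
  qed
  have Pint: "integrable ?M w" "integrable ?M W" if "P n w W" for n w W
  proof -
    show "integrable ?M w"
      using Pbd[OF that] that by (intro integrable_const_bound[of _ "A + 1"] AE_I2) (auto simp: P_def)
    show "integrable ?M W"
      using that by (intro integrable_const_bound[of _ 1]) (auto simp: P_def)
  qed
  have "\<exists>W. (\<forall>k. W k \<in> C k) \<and> (AE x in ?M. convergent (\<lambda>k. W k x))"
  proof (rule midpoint_convex_selection_AE_convergent[OF fin])
    show "decseq C"
    proof (rule decseq_SucI)
      fix n
      have "1 / real (Suc (Suc n)) \<le> 1 / real (Suc n)" by (simp add: field_simps)
      then show "C (Suc n) \<subseteq> C n" unfolding C_def P_def by (auto intro: order_trans)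
    qed
    show "C n \<noteq> {}" for n
    proof -
      have "\<forall>\<^sub>F m in sequentially. \<forall>x\<in>closure \<Omega>. dist (un m x) (u x) < 1 / real (Suc n)"
        using lim by (rule uniform_limitD) simp
      then obtain m where "\<forall>x\<in>closure \<Omega>. dist (un m x) (u x) < 1 / real (Suc n)"
        using eventually_happens by fastforce
      then have "P n (un m) (wgrad \<Omega> (un m))"
        using K_setD[OF un[of m]] closure_subset unfolding P_def by (force simp: dist_real_def)
      then show ?thesis unfolding C_def by blast
    qed
    show "W \<in> borel_measurable ?M" "AE x in ?M. norm (W x) \<le> 1" if "W \<in> C n" for n W
      using that unfolding C_def P_def by auto
    fix n V W assume "V \<in> C n" "W \<in> C n"
    then obtain v w where v: "P n v V" and w: "P n w W" unfolding C_def by blast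
    have "P n (\<lambda>x. (v x + w x) / 2) (\<lambda>x. (1/2) *\<^sub>R (V x + W x))"
      unfolding P_def
    proof (intro conjI ballI)
      have [measurable]: "v \<in> borel_measurable ?M" "w \<in> borel_measurable ?M"
        "V \<in> borel_measurable ?M" "W \<in> borel_measurable ?M" using v w unfolding P_def by auto
      show "(\<lambda>x. (v x + w x) / 2) \<in> borel_measurable ?M"
        "(\<lambda>x. (1/2) *\<^sub>R (V x + W x)) \<in> borel_measurable ?M" by measurable
      have "AE x in ?M. norm (V x) \<le> 1" "AE x in ?M. norm (W x) \<le> 1" using v w unfolding P_def by auto
      then show "AE x in ?M. norm ((1/2) *\<^sub>R (V x + W x)) \<le> 1"
      proof eventually_elim
        case (elim x)
        then show ?case using norm_triangle_ineq[of "V x" "W x"] by simp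
      qed
      show "is_weak_gradient \<Omega> (\<lambda>x. (v x + w x) / 2) (\<lambda>x. (1/2) *\<^sub>R (V x + W x))"
        using v w unfolding P_def
        by (intro is_weak_gradient_midpoint Pint[OF v] Pint[OF w]) blast+
      fix x assume "x \<in> \<Omega>"
      then have "\<bar>v x - u x\<bar> \<le> 1 / real (Suc n)" "\<bar>w x - u x\<bar> \<le> 1 / real (Suc n)"
        using v w unfolding P_def by auto
      moreover have "\<bar>(r + s) / 2 - t\<bar> \<le> e" if "\<bar>r - t\<bar> \<le> e" "\<bar>s - t\<bar> \<le> e" for r s t e :: real
        using that by (simp add: abs_le_iff field_simps)
      ultimately show "\<bar>(v x + w x) / 2 - u x\<bar> \<le> 1 / real (Suc n)" by blast
    qed
    then show "(\<lambda>x. (1/2) *\<^sub>R (V x + W x)) \<in> C n" unfolding C_def by blast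
  qed
  then obtain W where "\<And>k. W k \<in> C k" and conv: "AE x in ?M. convergent (\<lambda>k. W k x)" by blast
  then have "\<forall>k. \<exists>w. P k w (W k)" unfolding C_def by blast
  then obtain w where w: "\<And>k. P k (w k) (W k)" by metis
  have [measurable]: "W k \<in> borel_measurable ?M" for k using w unfolding P_def by blast
  define V where "V = (\<lambda>x. lim (\<lambda>k. W k x))"
  have [measurable]: "V \<in> borel_measurable ?M" unfolding V_def by (rule borel_measurable_lim_metric) simp
  have lW: "AE x in ?M. (\<lambda>k. W k x) \<longlonglongrightarrow> V x"
    using conv by eventually_elim (simp add: V_def convergent_LIMSEQ_iff)
  have lw: "(\<lambda>k. w k x) \<longlonglongrightarrow> u x" if "x \<in> \<Omega>" for x
  proof -
    have "(\<lambda>k. w k x - u x) \<longlonglongrightarrow> 0"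
    proof (rule Lim_null_comparison)
      show "\<forall>\<^sub>F k in sequentially. norm (w k x - u x) \<le> 1 / real (Suc k)"
        using w that unfolding P_def by auto
      show "(\<lambda>k. 1 / real (Suc k)) \<longlonglongrightarrow> 0"
        using LIMSEQ_inverse_real_of_nat by (simp add: inverse_eq_divide)
    qed
    then show ?thesis by (simp add: LIM_zero_iff)
  qed
  have "is_weak_gradient \<Omega> u V"
    by (rule weak_gradient_AE_limit[OF fin, of w W u V "A + 1" 1])
       (use w lw lW Pbd[OF w] in \<open>auto simp: P_def\<close>)
  moreover have "AE x in ?M. norm (V x) \<le> 1"
  proof -
    have "AE x in ?M. \<forall>k. norm (W k x) \<le> 1"
      using w unfolding P_def by (simp add: AE_all_countable)
    with lW show ?thesis
    proof eventually_elim
      case (elim x)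
      show ?case by (rule LIMSEQ_le_const2[OF tendsto_norm[OF elim(1)]]) (use elim(2) in auto)
    qed
  qed
  ultimately show ?thesis by (intro K_setI[OF \<Omega> cu, of V]) auto
qed

section \<open>The nonlinearity and the weighted integrals\<close>

lemma g_1_continuous:
  assumes "g_1 g" shows "continuous_on UNIV g"
  using assms unfolding g_1_def
  by (meson DERIV_isCont continuous_at_imp_continuous_on)

lemma g_1_sign:
  assumes "g_1 g" shows "s > 0 \<Longrightarrow> g s > 0" "s < 0 \<Longrightarrow> g s < 0"
  using assms unfolding g_1_def
  by (metis less_irrefl zero_less_mult_pos2, metis less_irrefl less_asym mult_neg_neg zero_less_mult_iff)

lemma primitive_0: "primitive g 0 = 0"
  by (simp add: primitive_def zero_ereal_def)

lemma primitive_deriv: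
  assumes g: "continuous_on UNIV g"
  shows "(primitive g has_real_derivative g s) (at s)"
proof -
  define r where "r = \<bar>s\<bar> + 1"
  have "((\<lambda>u. LBINT y=ereal 0..ereal u. g y) has_vector_derivative g s) (at s within {-r..r})"
    by (rule interval_integral_FTC2) (use continuous_on_subset[OF g] in \<open>auto simp: r_def\<close>)
  moreover have "at s within {-r..r} = at s"
    by (rule at_within_interior) (auto simp: r_def)
  ultimately show ?thesis
    unfolding primitive_def[abs_def] has_real_derivative_iff_has_vector_derivative by simp
qed

lemma primitive_continuous:
  assumes "continuous_on UNIV g" shows "continuous_on UNIV (primitive g)"
  using primitive_deriv[OF assms] by (meson DERIV_isCont continuous_at_imp_continuous_on)

lemma primitive_pos:
  assumes "g_1 g" "s > 0" shows "primitive g s > 0"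
proof -
  have "primitive g 0 < primitive g s"
  proof (rule DERIV_pos_imp_increasing_open[OF assms(2)])
    show "\<exists>y. (primitive g has_real_derivative y) (at x) \<and> 0 < y" if "0 < x" "x < s" for x
      using primitive_deriv[OF g_1_continuous[OF assms(1)], of x] g_1_sign(1)[OF assms(1) that(1)] by blast
    show "continuous_on {0..s} (primitive g)"
      using primitive_continuous[OF g_1_continuous[OF assms(1)]] continuous_on_subset by blast
  qed
  then show ?thesis by (simp add: primitive_0)
qed

text \<open>
  If \<open>\<bar>s\<bar> \<rightarrow> \<infinity>\<close> while \<open>t - s\<close> stays bounded, then \<open>t / s \<rightarrow> 1\<close>, and \<open>g\<close> is asymptotic to
  a multiple of \<open>\<bar>s\<bar> powr (p - 2) * s\<close>, so that \<open>g t / g s\<close> has the limit of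
  \<open>\<bar>t / s\<bar> powr (p - 2) * (t / s)\<close>.
\<close>

lemma g_2_ratio_near_1:
  assumes g1: "g_1 g" and g2: "g_2 g" and \<eta>: "\<eta> > 0"
  shows "\<exists>R>0. \<forall>s t. \<bar>s\<bar> \<ge> R \<longrightarrow> \<bar>t - s\<bar> \<le> d \<longrightarrow> \<bar>g t / g s - 1\<bar> \<le> \<eta>"
proof (rule ccontr)
  assume neg: "\<not> ?thesis"
  obtain p c where c: "c > 0" and lim: "((\<lambda>s. g s / (\<bar>s\<bar> powr (p - 2) * s)) \<longlongrightarrow> c) at_infinity"
    using g2 unfolding g_2_def by blast
  have "\<exists>s t. \<bar>s\<bar> \<ge> real (Suc n) \<and> \<bar>t - s\<bar> \<le> d \<and> \<not> \<bar>g t / g s - 1\<bar> \<le> \<eta>" for n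
    using neg by (meson of_nat_0_less_iff zero_less_Suc)
  then obtain S T where S: "\<And>n. \<bar>S n\<bar> \<ge> real (Suc n)" and T: "\<And>n. \<bar>T n - S n\<bar> \<le> d"
    and far: "\<And>n. \<not> \<bar>g (T n) / g (S n) - 1\<bar> \<le> \<eta>" by metis
  have absS: "filterlim (\<lambda>n. \<bar>S n\<bar>) at_top sequentially"
  proof (rule filterlim_at_top_mono[OF filterlim_real_sequentially], rule always_eventually, rule allI)
    fix n show "real n \<le> \<bar>S n\<bar>" using S[of n] by simp
  qed
  have absT: "filterlim (\<lambda>n. \<bar>T n\<bar>) at_top sequentially"
  proof (rule filterlim_at_top_mono)
    show "filterlim (\<lambda>n. - d + \<bar>S n\<bar>) at_top sequentially"
      by (rule filterlim_tendsto_add_at_top[OF tendsto_const absS])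
    show "\<forall>\<^sub>F n in sequentially. - d + \<bar>S n\<bar> \<le> \<bar>T n\<bar>"
    proof (rule always_eventually, rule allI)
      fix n show "- d + \<bar>S n\<bar> \<le> \<bar>T n\<bar>" using T[of n] by linarith
    qed
  qed
  have infS: "filterlim S at_infinity sequentially" and infT: "filterlim T at_infinity sequentially"
    using absS absT by (auto simp: filterlim_at_infinity_conv_norm_at_top)
  define q where "q = (\<lambda>s. g s / (\<bar>s\<bar> powr (p - 2) * s))"
  have qS: "(\<lambda>n. q (S n)) \<longlonglongrightarrow> c" and qT: "(\<lambda>n. q (T n)) \<longlonglongrightarrow> c"
    using filterlim_compose[OF lim infS] filterlim_compose[OF lim infT] by (auto simp: q_def)
  have S0: "S n \<noteq> 0" for n using S[of n] by auto
  have ratio: "(\<lambda>n. T n / S n) \<longlonglongrightarrow> 1"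
  proof -
    have "(\<lambda>n. (T n - S n) / S n) \<longlonglongrightarrow> 0"
    proof (rule Lim_null_comparison)
      show "\<forall>\<^sub>F n in sequentially. norm ((T n - S n) / S n) \<le> d / \<bar>S n\<bar>"
        using T by (auto simp: abs_divide intro!: always_eventually divide_right_mono)
      show "(\<lambda>n. d / \<bar>S n\<bar>) \<longlonglongrightarrow> 0"
        by (intro tendsto_divide_0[OF tendsto_const] filterlim_at_top_imp_at_infinity absS)
    qed
    then have "(\<lambda>n. 1 + (T n - S n) / S n) \<longlonglongrightarrow> 1 + 0" by (intro tendsto_intros)
    moreover have "1 + (T n - S n) / S n = T n / S n" for n using S0[of n] by (simp add: field_simps)
    ultimately show ?thesis by simp
  qed
  have "(\<lambda>n. q (T n) / q (S n) * (\<bar>T n / S n\<bar> powr (p - 2) * (T n / S n))) \<longlonglongrightarrow> c / c * (\<bar>1\<bar> powr (p - 2) * 1)"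
    using c by (intro tendsto_intros qS qT ratio) auto
  then have main: "(\<lambda>n. q (T n) / q (S n) * (\<bar>T n / S n\<bar> powr (p - 2) * (T n / S n))) \<longlonglongrightarrow> 1" using c by simp
  have T0: "\<forall>\<^sub>F n in sequentially. T n \<noteq> 0"
    using filterlim_at_top_dense[THEN iffD1, OF absT, rule_format, of 0] by (auto elim: eventually_mono)
  have "(\<lambda>n. g (T n) / g (S n)) \<longlonglongrightarrow> 1"
  proof (rule Lim_transform_eventually[OF main])
    show "\<forall>\<^sub>F n in sequentially. q (T n) / q (S n) * (\<bar>T n / S n\<bar> powr (p - 2) * (T n / S n)) = g (T n) / g (S n)"
      using T0
    proof eventually_elim
      case (elim n)
      have gs: "g (S n) \<noteq> 0" using S0[of n] g1 unfolding g_1_def by force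
      define \<sigma> \<tau> where "\<sigma> = \<bar>S n\<bar> powr (p - 2)" and "\<tau> = \<bar>T n\<bar> powr (p - 2)"
      have pos: "\<sigma> > 0" "\<tau> > 0" using S0[of n] elim by (auto simp: \<sigma>_def \<tau>_def)
      have "\<bar>T n / S n\<bar> powr (p - 2) = \<tau> / \<sigma>"
        unfolding \<sigma>_def \<tau>_def by (simp add: abs_divide powr_divide)
      then show ?case
        unfolding q_def \<sigma>_def[symmetric] \<tau>_def[symmetric] using pos gs S0[of n] elim by (simp add: field_simps)
    qed
  qed
  then have "\<forall>\<^sub>F n in sequentially. dist (g (T n) / g (S n)) 1 < \<eta>" using \<eta> by (rule tendstoD)
  then obtain n where "dist (g (T n) / g (S n)) 1 < \<eta>" using eventually_happens by fastforce
  then show False using far[of n] by (simp add: dist_real_def)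
qed

lemma integrable_bounded_times_Linf:
  fixes a F :: "'a::euclidean_space \<Rightarrow> real"
  assumes \<Omega>: "open \<Omega>" "bounded \<Omega>" and a: "a \<in> Linf \<Omega>"
    and F: "continuous_on (closure \<Omega>) F"
  shows "integrable (lebesgue_on \<Omega>) (\<lambda>x. a x * F x)"
proof -
  interpret finite_measure "lebesgue_on \<Omega>" by (rule finite_measure_lebesgue_on_open[OF \<Omega>])
  obtain A where [measurable]: "a \<in> borel_measurable (lebesgue_on \<Omega>)"
    and A: "AE x in lebesgue_on \<Omega>. norm (a x) \<le> A" using a unfolding Linf_iff by blast
  have [measurable]: "F \<in> borel_measurable (lebesgue_on \<Omega>)"
    using continuous_on_subset[OF F closure_subset] \<Omega> by (intro continuous_imp_measurable_on_sets_lebesgue) auto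
  have "bounded (F ` closure \<Omega>)"
    using F \<Omega>(2) by (intro compact_imp_bounded compact_continuous_image) (auto simp: compact_closure)
  then obtain B where B: "\<And>x. x \<in> closure \<Omega> \<Longrightarrow> norm (F x) \<le> B" by (auto simp: bounded_iff)
  have "AE x in lebesgue_on \<Omega>. norm (F x) \<le> B"
    using B closure_subset by (intro AE_I2) (auto simp: subset_eq)
  with A have "AE x in lebesgue_on \<Omega>. norm (a x * F x) \<le> A * B"
    by eventually_elim (auto simp: abs_mult intro!: mult_mono dest: order_trans[OF abs_ge_zero])
  then show ?thesis by (intro integrable_const_bound) auto
qed

lemma integral_weighted_uniform_limit:
  fixes a :: "'a::euclidean_space \<Rightarrow> real" and f :: "real \<Rightarrow> real"
  assumes \<Omega>: "open \<Omega>" "bounded \<Omega>" and a: "a \<in> Linf \<Omega>" and f: "continuous_on UNIV f"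
    and un: "\<And>n. continuous_on (closure \<Omega>) (un n)" and u: "continuous_on (closure \<Omega>) u"
    and bd: "\<And>n x. x \<in> closure \<Omega> \<Longrightarrow> \<bar>un n x\<bar> \<le> R"
    and lim: "\<And>x. x \<in> closure \<Omega> \<Longrightarrow> (\<lambda>n. un n x) \<longlonglongrightarrow> u x"
  shows "(\<lambda>n. \<integral>x. a x * f (un n x) \<partial>lebesgue_on \<Omega>) \<longlonglongrightarrow> (\<integral>x. a x * f (u x) \<partial>lebesgue_on \<Omega>)"
proof -
  interpret finite_measure "lebesgue_on \<Omega>" by (rule finite_measure_lebesgue_on_open[OF \<Omega>])
  obtain A where ma: "a \<in> borel_measurable (lebesgue_on \<Omega>)"
    and A: "AE x in lebesgue_on \<Omega>. norm (a x) \<le> A" using a unfolding Linf_iff by blast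
  have "bounded (f ` {-R..R})"
    using continuous_on_subset[OF f] by (intro compact_imp_bounded compact_continuous_image) auto
  then obtain B where B: "\<And>s. \<bar>s\<bar> \<le> R \<Longrightarrow> norm (f s) \<le> B"
    unfolding bounded_iff by (metis abs_le_iff atLeastAtMost_iff imageI minus_le_iff)
  have comp: "continuous_on (closure \<Omega>) (\<lambda>x. f (v x))" if "continuous_on (closure \<Omega>) v" for v
    by (rule continuous_on_compose2[OF f that]) auto
  note i = integrable_bounded_times_Linf[OF \<Omega> a comp]
  show ?thesis
  proof (rule integral_dominated_convergence[where w="\<lambda>_. A * B"])
    show "AE x in lebesgue_on \<Omega>. (\<lambda>n. a x * f (un n x)) \<longlonglongrightarrow> a x * f (u x)"
    proof (rule AE_I2)
      fix x assume "x \<in> space (lebesgue_on \<Omega>)"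
      then have x: "x \<in> closure \<Omega>" using closure_subset by auto
      show "(\<lambda>n. a x * f (un n x)) \<longlonglongrightarrow> a x * f (u x)"
        by (intro tendsto_mult tendsto_const continuous_on_tendsto_compose[OF f lim[OF x]]) auto
    qed
    fix n
    have "AE x in lebesgue_on \<Omega>. norm (f (un n x)) \<le> B"
      using closure_subset by (intro AE_I2 B bd) auto
    with A show "AE x in lebesgue_on \<Omega>. norm (a x * f (un n x)) \<le> A * B"
      by eventually_elim (auto simp: abs_mult intro!: mult_mono dest: order_trans[OF abs_ge_zero])
  qed (use borel_measurable_integrable[OF i[OF un]] borel_measurable_integrable[OF i[OF u]] in auto)
qed

text \<open>
  Elements of \<open>K\<close> oscillate by at most the diameter of \<open>\<Omega>\<close>. If such a function were large at one
  point \<open>x0\<close>, then \<open>g (u x) / g (u x0)\<close> would be uniformly close to \<open>1\<close>, and the integral of \<open>a x * g (u x)\<close>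
  divided by \<open>g (u x0)\<close> would be close to the integral of \<open>a\<close>, which is negative, instead of being zero.
\<close>

lemma K_a_uniformly_bounded:
  fixes \<Omega> :: "'a::euclidean_space set"
  assumes \<Omega>: "open \<Omega>" "bounded \<Omega>" "convex \<Omega>" and a: "a_star \<Omega> a" and g1: "g_1 g" and g2: "g_2 g"
  shows "\<exists>R. \<forall>u\<in>K_a \<Omega> a g. \<forall>x\<in>closure \<Omega>. \<bar>u x\<bar> \<le> R"
proof -
  interpret finite_measure "lebesgue_on \<Omega>" by (rule finite_measure_lebesgue_on_open[OF \<Omega>(1,2)])
  have aL: "a \<in> Linf \<Omega>" and neg: "(\<integral>x. a x \<partial>lebesgue_on \<Omega>) < 0" using a by (auto simp: a_star_def)
  have ia: "integrable (lebesgue_on \<Omega>) a"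
    using aL unfolding Linf_iff by (blast intro: integrable_const_bound)
  define m where "m = - (\<integral>x. a x \<partial>lebesgue_on \<Omega>)"
  define A where "A = (\<integral>x. \<bar>a x\<bar> \<partial>lebesgue_on \<Omega>)"
  have A0: "A \<ge> 0" by (simp add: A_def)
  \<comment> \<open>Small enough for the deviation eta * A to stay below m; the summand 1 avoids a separate
    argument that A is positive.\<close>
  define \<eta> where "\<eta> = m / (2 * (A + 1))"
  have m: "m > 0" using neg by (simp add: m_def)
  have \<eta>: "\<eta> > 0" "\<eta> * A < m"
  proof -
    show "\<eta> > 0" using m A0 by (simp add: \<eta>_def)
    have "\<eta> * A \<le> m / 2" using m A0 by (simp add: \<eta>_def field_simps)
    then show "\<eta> * A < m" using m by linarith
  qed
  obtain d where d: "\<And>x y. x \<in> closure \<Omega> \<Longrightarrow> y \<in> closure \<Omega> \<Longrightarrow> dist x y \<le> d"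
    using bounded_two_points[THEN iffD1, OF bounded_closure[OF \<Omega>(2)]] by auto
  obtain R where R: "R > 0" "\<And>s t. \<bar>s\<bar> \<ge> R \<Longrightarrow> \<bar>t - s\<bar> \<le> d \<Longrightarrow> \<bar>g t / g s - 1\<bar> \<le> \<eta>"
    using g_2_ratio_near_1[OF g1 g2 \<eta>(1), of d] by blast
  have "\<bar>u x0\<bar> \<le> R" if u: "u \<in> K_a \<Omega> a g" and x0: "x0 \<in> closure \<Omega>" for u x0
  proof (rule ccontr)
    assume "\<not> \<bar>u x0\<bar> \<le> R"
    then have big: "\<bar>u x0\<bar> \<ge> R" by simp
    have uK: "u \<in> K_set \<Omega>" and u0: "(\<integral>x. a x * g (u x) \<partial>lebesgue_on \<Omega>) = 0"
      using u by (auto simp: K_a_def)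
    have "u x0 \<noteq> 0" using big R(1) by auto
    then have gne: "g (u x0) \<noteq> 0"
      using g_1_sign[OF g1, of "u x0"] by (cases "u x0 > 0") auto
    have iag: "integrable (lebesgue_on \<Omega>) (\<lambda>x. a x * g (u x))"
      by (intro integrable_bounded_times_Linf[OF \<Omega>(1,2) aL]
          continuous_on_compose2[OF g_1_continuous[OF g1] K_setD(1)[OF uK]]) auto
    have osc: "\<bar>u x - u x0\<bar> \<le> d" if "x \<in> closure \<Omega>" for x
      using lipschitz_onD[OF K_set_lipschitz[OF \<Omega> uK] that x0] d[OF that x0] by (simp add: dist_real_def)
    have "- m = (\<integral>x. a x \<partial>lebesgue_on \<Omega>) - (\<integral>x. a x * g (u x) \<partial>lebesgue_on \<Omega>) / g (u x0)"
      using u0 by (simp add: m_def)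
    also have "\<dots> = (\<integral>x. - (a x * (g (u x) / g (u x0) - 1)) \<partial>lebesgue_on \<Omega>)"
      using ia iag by (simp add: right_diff_distrib)
    also have "\<dots> \<ge> - (\<eta> * A)"
    proof -
      have "norm (\<integral>x. - (a x * (g (u x) / g (u x0) - 1)) \<partial>lebesgue_on \<Omega>) \<le> (\<integral>x. \<eta> * \<bar>a x\<bar> \<partial>lebesgue_on \<Omega>)"
      proof (rule Bochner_Integration.integral_norm_bound_integral)
        show "integrable (lebesgue_on \<Omega>) (\<lambda>x. - (a x * (g (u x) / g (u x0) - 1)))"
          using ia iag by (simp add: right_diff_distrib)
        show "integrable (lebesgue_on \<Omega>) (\<lambda>x. \<eta> * \<bar>a x\<bar>)" using ia by simp
        fix x assume "x \<in> space (lebesgue_on \<Omega>)"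
        then have x: "x \<in> closure \<Omega>" using closure_subset by auto
        show "norm (- (a x * (g (u x) / g (u x0) - 1))) \<le> \<eta> * \<bar>a x\<bar>"
          using mult_right_mono[OF R(2)[OF big osc[OF x]], of "\<bar>a x\<bar>"] by (simp add: abs_mult mult.commute)
      qed
      then show ?thesis by (simp add: A_def abs_le_iff)
    qed
    finally show False using \<eta>(2) by linarith
  qed
  then show ?thesis by blast
qed

text \<open>
  A small bump supported where \<open>a\<close> is positive, divided by a bound of its gradient. It lies in \<open>K\<close>
  but not in \<open>K_a \<Omega> a g\<close>, because the integral of \<open>a x * g (v x)\<close> is positive as well.
\<close>

lemma exists_K_set_positive_G_integral:
  fixes \<Omega> :: "'a::euclidean_space set"
  assumes \<Omega>: "open \<Omega>" "bounded \<Omega>" and a: "a \<in> Linf \<Omega>" "a_plus \<Omega> a" and g1: "g_1 g"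
  shows "\<exists>v\<in>K_set \<Omega>. G_integral \<Omega> a g v > 0"
proof -
  obtain x0 where "x0 \<in> interior {x \<in> \<Omega>. a x > 0}" using a(2) by (auto simp: a_plus_def)
  then obtain r where r: "r > 0" "cball x0 r \<subseteq> {x \<in> \<Omega>. a x > 0}"
    by (meson interior_subset open_contains_cball open_interior order_trans)
  obtain \<rho> :: "'a \<Rightarrow> real" and D where \<rho>: "C1_gradient \<rho> D" "\<And>x. \<rho> x \<ge> 0" "\<rho> 0 > 0"
    "\<And>x. x \<notin> cball 0 r \<Longrightarrow> \<rho> x = 0"
    using small_box_bump[OF r(1)] by blast
  have c\<rho>: "continuous_on UNIV \<rho>" "continuous_on UNIV D"
    using \<rho>(1) C1_gradient_continuous unfolding C1_gradient_def by blast+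
  have Dz: "D z = 0" if "z \<notin> cball 0 r" for z
    by (rule C1_gradient_zero_outside[OF \<rho>(1) closed_cball \<rho>(4) that])
  obtain L where L: "L > 0" "\<And>z. norm (D z) \<le> L" using compact_support_bounded[OF c\<rho>(2) compact_cball Dz] by blast
  define v where "v = (\<lambda>x. (1 / L) * \<rho> (x - x0))"
  have C1: "C1_gradient v (\<lambda>x. (1 / L) *\<^sub>R D (x - x0))"
    using C1_gradient_mult[OF C1_gradient_const[of "1 / L"] C1_gradient_translate[OF \<rho>(1), of x0]]
    by (simp add: v_def)
  have cv: "continuous_on UNIV v" by (rule C1_gradient_continuous[OF C1])
  have vK: "v \<in> K_set \<Omega>"
  proof (rule K_setI[OF \<Omega> continuous_on_subset[OF cv]])
    show "is_weak_gradient \<Omega> v (\<lambda>x. (1 / L) *\<^sub>R D (x - x0))"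
      by (rule C1_gradient_is_weak_gradient[OF C1 \<Omega>])
    show "(\<lambda>x. (1 / L) *\<^sub>R D (x - x0)) \<in> borel_measurable (lebesgue_on \<Omega>)"
      using C1 unfolding C1_gradient_def by (blast intro: borel_measurable_lebesgue_on_continuous)
    show "AE x in lebesgue_on \<Omega>. norm ((1 / L) *\<^sub>R D (x - x0)) \<le> 1"
      using L by (intro AE_I2) (simp add: field_simps)
  qed auto
  have "G_integral \<Omega> a g v > 0"
    unfolding G_integral_def
  proof (rule integral_pos_if_pos_on_open[where U="{x. \<rho> (x - x0) > 0}"])
    show "integrable (lebesgue_on \<Omega>) (\<lambda>x. a x * primitive g (v x))"
      by (intro integrable_bounded_times_Linf[OF \<Omega> a(1)]
          continuous_on_compose2[OF primitive_continuous[OF g_1_continuous[OF g1]] continuous_on_subset[OF cv]]) auto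
    have supp: "a x > 0" "x \<in> \<Omega>" if "\<rho> (x - x0) \<noteq> 0" for x
    proof -
      have "x \<in> cball x0 r" using \<rho>(4)[of "x - x0"] that by (auto simp: dist_norm norm_minus_commute)
      then show "a x > 0" "x \<in> \<Omega>" using r(2) by auto
    qed
    show pos: "a x * primitive g (v x) > 0" if "x \<in> {x. \<rho> (x - x0) > 0}" for x
      using that supp[of x] primitive_pos[OF g1, of "v x"] L(1) by (simp add: v_def)
    show "a x * primitive g (v x) \<ge> 0" for x
    proof (cases "\<rho> (x - x0) > 0")
      case True
      then show ?thesis using pos[of x] by simp
    next
      case False
      then have "\<rho> (x - x0) = 0" using \<rho>(2)[of "x - x0"] by linarith
      then show ?thesis by (simp add: v_def primitive_0)
    qed
    show "open {x. \<rho> (x - x0) > 0}"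
      by (intro open_Collect_less continuous_on_compose2[OF c\<rho>(1)] continuous_intros) auto
    show "{x. \<rho> (x - x0) > 0} \<noteq> {}" using \<rho>(3) by (auto intro!: exI[of _ x0])
    show "{x. \<rho> (x - x0) > 0} \<subseteq> \<Omega>" using supp by fastforce
  qed (use \<Omega> in auto)
  then show ?thesis using vK by blast
qed

section \<open>Convergence of minimising solutions\<close>

text \<open>
  Test the equation with the constant function \<open>1\<close>.
\<close>

lemma is_solution_in_K_a:
  assumes sol: "is_solution \<Omega> a g lam u" and lam: "lam \<noteq> 0"
  shows "u \<in> K_a \<Omega> a g"
proof -
  have "u \<in> K_set \<Omega>" using sol unfolding is_solution_def K_set_def by auto
  moreover have "C1_closure \<Omega> (\<lambda>_. 1) (\<lambda>_. 0)"
    unfolding C1_closure_def by (auto intro: GDERIV_const)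
  then have "(\<integral>x. (wgrad \<Omega> u x \<bullet> 0) / sqrt (1 - (norm (wgrad \<Omega> u x))\<^sup>2) \<partial>lebesgue_on \<Omega>)
      = lam * (\<integral>x. a x * g (u x) * 1 \<partial>lebesgue_on \<Omega>)"
    using sol unfolding is_solution_def by blast
  ultimately show ?thesis using lam unfolding K_a_def by simp
qed

lemma \<Psi>_bounds:
  assumes \<Omega>: "open \<Omega>" "bounded \<Omega>" and u: "u \<in> K_set \<Omega>"
  obtains \<psi> where "\<Psi> \<Omega> u = ereal \<psi>" "0 \<le> \<psi>" "\<psi> \<le> measure lebesgue \<Omega>"
proof -
  interpret finite_measure "lebesgue_on \<Omega>" by (rule finite_measure_lebesgue_on_open[OF \<Omega>])
  let ?f = "\<lambda>x. 1 - sqrt (1 - (norm (wgrad \<Omega> u x))\<^sup>2)"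
  note [measurable] = K_setD(3)[OF u]
  have b: "AE x in lebesgue_on \<Omega>. 0 \<le> ?f x \<and> ?f x \<le> 1"
    using K_setD(5)[OF u]
  proof eventually_elim
    case (elim x)
    then have "(norm (wgrad \<Omega> u x))\<^sup>2 \<le> 1" by (simp add: power_le_one)
    then show ?case by (simp add: real_sqrt_le_1_iff)
  qed
  have i: "integrable (lebesgue_on \<Omega>) ?f"
    by (rule integrable_const_bound[of _ 1]) (use b in \<open>auto elim: eventually_mono\<close>)
  have "0 \<le> (\<integral>x. ?f x \<partial>lebesgue_on \<Omega>)"
    using b by (intro integral_nonneg_AE) (auto elim: eventually_mono)
  moreover have "(\<integral>x. ?f x \<partial>lebesgue_on \<Omega>) \<le> (\<integral>x. 1 \<partial>lebesgue_on \<Omega>)"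
    using b by (intro integral_mono_AE i) (auto elim: eventually_mono)
  moreover have "(\<integral>x. (1::real) \<partial>lebesgue_on \<Omega>) = measure lebesgue \<Omega>"
    using \<Omega>(1) by (simp add: measure_restrict_space)
  ultimately show ?thesis using that u unfolding \<Psi>_def by auto
qed

text \<open>
  \<open>\<Psi>\<close> takes values between \<open>0\<close> and the measure of \<open>\<Omega>\<close> on \<open>K\<close>, while the other term of the functional is
  multiplied by \<open>lam\<close>. The comparison function \<open>v\<close> ranges over \<open>K\<close> and not only over \<open>K_a \<Omega> a g\<close>; this is what
  permits a comparison with a bump and makes the limit nontrivial.
\<close>

lemma minimizer_G_integral_almost_maximal:
  assumes \<Omega>: "open \<Omega>" "bounded \<Omega>" and lam: "lam > 0"
    and u: "u \<in> K_set \<Omega>" "I_functional \<Omega> a g lam u = I_inf \<Omega> a g lam" and v: "v \<in> K_set \<Omega>"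
  shows "G_integral \<Omega> a g v \<le> G_integral \<Omega> a g u + measure lebesgue \<Omega> / lam"
proof -
  obtain \<psi>u where \<psi>u: "\<Psi> \<Omega> u = ereal \<psi>u" "0 \<le> \<psi>u" using \<Psi>_bounds[OF \<Omega> u(1)] by blast
  obtain \<psi>v where \<psi>v: "\<Psi> \<Omega> v = ereal \<psi>v" "\<psi>v \<le> measure lebesgue \<Omega>" using \<Psi>_bounds[OF \<Omega> v] by blast
  have "v \<in> C_closure \<Omega>" using v by (simp add: K_set_def)
  then have "I_functional \<Omega> a g lam u \<le> I_functional \<Omega> a g lam v"
    unfolding u(2) I_inf_def by (rule INF_lower)
  then have "\<psi>u - lam * G_integral \<Omega> a g u \<le> \<psi>v - lam * G_integral \<Omega> a g v"
    unfolding I_functional_def \<psi>u \<psi>v by simp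
  then have "lam * (G_integral \<Omega> a g v - G_integral \<Omega> a g u) \<le> measure lebesgue \<Omega>"
    using \<psi>u(2) \<psi>v(2) by (simp add: algebra_simps)
  then have "G_integral \<Omega> a g v - G_integral \<Omega> a g u \<le> measure lebesgue \<Omega> / lam"
    using lam by (simp add: pos_le_divide_eq mult.commute)
  then show ?thesis by linarith
qed

text \<open>
  Compactness of \<open>K_a \<Omega> a g\<close> in \<open>C(closure \<Omega>)\<close>, by the Arzela--Ascoli theorem: the functions are bounded by
  a common constant and are Lipschitz with constant 1.
\<close>

lemma K_a_subsequence_uniform_limit:
  fixes \<Omega> :: "'a::euclidean_space set" and U :: "nat \<Rightarrow> 'a \<Rightarrow> real"
  assumes \<Omega>: "open \<Omega>" "bounded \<Omega>" "convex \<Omega>" and a: "a_star \<Omega> a" and g1: "g_1 g" and g2: "g_2 g"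
    and U: "\<And>n. U n \<in> K_a \<Omega> a g"
  obtains r u where "strict_mono (r :: nat \<Rightarrow> nat)" "uniform_limit (closure \<Omega>) (\<lambda>n. U (r n)) u sequentially"
    "u \<in> K_a \<Omega> a g" "(\<lambda>n. G_integral \<Omega> a g (U (r n))) \<longlonglongrightarrow> G_integral \<Omega> a g u"
proof -
  have aL: "a \<in> Linf \<Omega>" using a by (simp add: a_star_def)
  have UK: "U n \<in> K_set \<Omega>" for n using U by (auto simp: K_a_def)
  obtain R where R: "\<And>n x. x \<in> closure \<Omega> \<Longrightarrow> \<bar>U n x\<bar> \<le> R"
    using K_a_uniformly_bounded[OF \<Omega> a g1 g2] U by blast
  have cpt: "compact (closure \<Omega>)" using \<Omega>(2) by (simp add: compact_closure)
  obtain u r where cu: "continuous_on (closure \<Omega>) u" and r: "strict_mono (r :: nat \<Rightarrow> nat)"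
    and lim: "\<And>e. 0 < e \<Longrightarrow> \<exists>N. \<forall>n x. n \<ge> N \<and> x \<in> closure \<Omega> \<longrightarrow> norm (U (r n) x - u x) < e"
  proof (rule Arzela_Ascoli[OF cpt, of U R])
    show "norm (U n x) \<le> R" if "x \<in> closure \<Omega>" for n x using R[OF that] by simp
    fix e :: real and x :: 'a assume x: "x \<in> closure \<Omega>" and e: "0 < (e::real)"
    show "\<exists>d>0. \<forall>n y. y \<in> closure \<Omega> \<and> norm (x - y) < d \<longrightarrow> norm (U n x - U n y) < e"
    proof (intro exI[of _ e] conjI allI impI)
      fix n y assume y: "y \<in> closure \<Omega> \<and> norm (x - y) < e"
      show "norm (U n x - U n y) < e"
        using lipschitz_onD[OF K_set_lipschitz[OF \<Omega> UK[of n]] x, of y] y by (simp add: dist_norm)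
    qed (rule e)
  qed blast
  have unif: "uniform_limit (closure \<Omega>) (\<lambda>n. U (r n)) u sequentially"
    unfolding uniform_limit_sequentially_iff
    using lim by (metis dist_norm)
  have ptw: "(\<lambda>n. U (r n) x) \<longlonglongrightarrow> u x" if "x \<in> closure \<Omega>" for x
    using tendsto_uniform_limitI[OF unif that] .
  have uK: "u \<in> K_set \<Omega>"
    by (rule K_set_closed_uniform_limit[OF \<Omega>(1,2) UK unif])
  have conv: "(\<lambda>n. \<integral>x. a x * f (U (r n) x) \<partial>lebesgue_on \<Omega>) \<longlonglongrightarrow> (\<integral>x. a x * f (u x) \<partial>lebesgue_on \<Omega>)"
    if "continuous_on UNIV f" for f
    by (rule integral_weighted_uniform_limit[OF \<Omega>(1,2) aL that K_setD(1)[OF UK] cu R ptw])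
  have "(\<integral>x. a x * g (u x) \<partial>lebesgue_on \<Omega>) = 0"
    using conv[OF g_1_continuous[OF g1]] U by (simp add: K_a_def LIMSEQ_const_iff)
  then have "u \<in> K_a \<Omega> a g" using uK by (simp add: K_a_def)
  moreover have "(\<lambda>n. G_integral \<Omega> a g (U (r n))) \<longlonglongrightarrow> G_integral \<Omega> a g u"
    unfolding G_integral_def by (rule conv[OF primitive_continuous[OF g_1_continuous[OF g1]]])
  ultimately show ?thesis using that r unif by blast
qed

text \<open>
  The limit maximises over all of \<open>K\<close>, and the maximum over \<open>K\<close> is positive, so the limit is not zero.
\<close>

lemma minimizing_solutions_subconverge:
  fixes \<Omega> :: "'a::euclidean_space set"
  assumes \<Omega>: "bounded_convex_C2_domain \<Omega>" and a: "a_star \<Omega> a" "a_plus \<Omega> a"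
    and g: "g_1 g" "g_2 g" and M: "M > 0"
    and sol: "\<And>lam. lam \<ge> M \<Longrightarrow> is_solution \<Omega> a g lam (u lam)"
    and min: "\<And>lam. lam \<ge> M \<Longrightarrow> I_functional \<Omega> a g lam (u lam) = I_inf \<Omega> a g lam"
  shows "subconverges_to_maximizer \<Omega> a g M u"
  unfolding subconverges_to_maximizer_def
proof (intro allI impI)
  fix l :: "nat \<Rightarrow> real" assume lM: "\<forall>n. M \<le> l n" and l: "filterlim l at_top sequentially"
  have \<Omega>': "open \<Omega>" "bounded \<Omega>" "convex \<Omega>" using \<Omega> by (auto simp: bounded_convex_C2_domain_def)
  have lpos: "l n > 0" for n using lM M by (meson less_le_trans)
  have Ka: "u (l n) \<in> K_a \<Omega> a g" for n
    using is_solution_in_K_a[OF sol] lM lpos[of n] by (metis less_irrefl)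
  obtain r w where r: "strict_mono r" and unif: "uniform_limit (closure \<Omega>) (\<lambda>n. u (l (r n))) w sequentially"
    and w: "w \<in> K_a \<Omega> a g" and lim: "(\<lambda>n. G_integral \<Omega> a g (u (l (r n)))) \<longlonglongrightarrow> G_integral \<Omega> a g w"
    using K_a_subsequence_uniform_limit[OF \<Omega>' a(1) g, of "\<lambda>n. u (l n)"] Ka by blast
  have maxK: "G_integral \<Omega> a g v \<le> G_integral \<Omega> a g w" if v: "v \<in> K_set \<Omega>" for v
  proof (rule LIMSEQ_le_const)
    have "filterlim (\<lambda>n. l (r n)) at_top sequentially"
      using filterlim_compose[OF l filterlim_subseq[OF r]] .
    then have "(\<lambda>n. measure lebesgue \<Omega> / l (r n)) \<longlonglongrightarrow> 0"
      by (intro tendsto_divide_0[OF tendsto_const] filterlim_at_top_imp_at_infinity)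
    from tendsto_add[OF lim this]
    show "(\<lambda>n. G_integral \<Omega> a g (u (l (r n))) + measure lebesgue \<Omega> / l (r n)) \<longlonglongrightarrow> G_integral \<Omega> a g w"
      by simp
    show "\<exists>N. \<forall>n\<ge>N. G_integral \<Omega> a g v \<le> G_integral \<Omega> a g (u (l (r n))) + measure lebesgue \<Omega> / l (r n)"
      using minimizer_G_integral_almost_maximal[OF \<Omega>'(1,2) lpos _ min v] Ka lM by (auto simp: K_a_def)
  qed
  have "nontrivial_on_closure \<Omega> w"
  proof (rule ccontr)
    assume "\<not> nontrivial_on_closure \<Omega> w"
    then have "w x = 0" if "x \<in> \<Omega>" for x
      using that closure_subset unfolding nontrivial_on_closure_def by blast
    then have "G_integral \<Omega> a g w = (\<integral>x. 0 \<partial>lebesgue_on \<Omega>)"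
      unfolding G_integral_def by (intro Bochner_Integration.integral_cong) (auto simp: primitive_0)
    moreover obtain v where "v \<in> K_set \<Omega>" "G_integral \<Omega> a g v > 0"
      using exists_K_set_positive_G_integral[OF \<Omega>'(1,2) _ a(2) g(1)] a(1) by (auto simp: a_star_def)
    ultimately show False using maxK[of v] by simp
  qed
  moreover have "solves_max_problem \<Omega> a g w"
    using w maxK by (auto simp: solves_max_problem_def K_a_def)
  ultimately show "\<exists>r u_inf. strict_mono (r :: nat \<Rightarrow> nat) \<and>
      uniform_limit (closure \<Omega>) (\<lambda>n. u (l (r n))) u_inf sequentially \<and>
      solves_max_problem \<Omega> a g u_inf \<and> nontrivial_on_closure \<Omega> u_inf"
    using r unif by blast
qed

theorem proposition4p2:
  fixes \<Omega> :: "'a::euclidean_space set"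
    and a :: "'a \<Rightarrow> real"
    and g :: "real \<Rightarrow> real"
    and M :: real
  assumes "DIM('a) \<ge> 2"
    and "bounded_convex_C2_domain \<Omega>"
    and "a_star \<Omega> a" and "a_plus \<Omega> a"
    and "g_1 g" and "g_2 g" and "g_3 g"
    and "M > 0"
  shows
    "(\<forall>u :: real \<Rightarrow> 'a \<Rightarrow> real.
        (\<forall>lam\<ge>M. is_solution \<Omega> a g lam (u lam) \<and>
                I_functional \<Omega> a g lam (u lam) = I_inf \<Omega> a g lam)
        \<longrightarrow> subconverges_to_maximizer \<Omega> a g M u) \<and>
     (\<forall>u :: real \<Rightarrow> 'a \<Rightarrow> real.
        (\<forall>lam\<ge>M. is_solution \<Omega> a g lam (u lam) \<and> nontrivial_on_closure \<Omega> (u lam) \<and>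
                I_functional \<Omega> a g lam (u lam) = I_inf \<Omega> a g lam \<and> I_inf \<Omega> a g lam < 0)
        \<longrightarrow> subconverges_to_maximizer \<Omega> a g M u)"
proof (intro conjI allI impI)
  fix u :: "real \<Rightarrow> 'a \<Rightarrow> real"
  assume "\<forall>lam\<ge>M. is_solution \<Omega> a g lam (u lam) \<and> I_functional \<Omega> a g lam (u lam) = I_inf \<Omega> a g lam"
  then show "subconverges_to_maximizer \<Omega> a g M u"
    by (intro minimizing_solutions_subconverge[OF assms(2-6,8)]) blast+
next
  fix u :: "real \<Rightarrow> 'a \<Rightarrow> real"
  assume "\<forall>lam\<ge>M. is_solution \<Omega> a g lam (u lam) \<and> nontrivial_on_closure \<Omega> (u lam) \<and>
                I_functional \<Omega> a g lam (u lam) = I_inf \<Omega> a g lam \<and> I_inf \<Omega> a g lam < 0"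
  then show "subconverges_to_maximizer \<Omega> a g M u"
    by (intro minimizing_solutions_subconverge[OF assms(2-6,8)]) blast+
qed

end
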